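(* Let $K_0>0$, $\alpha>-1$, $\beta>-1$, $h_0\in\mathbb R$. (1) Every solution $v$ of $-\Delta v=2K_0|x|^{2\alpha}e^v$ in $\mathbb R^2$ satisfies $\mathrm{ind}(v)\ge1$; moreover, if $\int_{\mathbb R^2}|x|^{2\alpha}e^v=\infty$ then $\mathrm{ind}(v)=\infty$. (2) Every solution $v$ of $-\Delta v=2K_0|x|^{2\beta}e^v$ in $\mathbb R^2_+$, $\partial_\nu v=2h_0|x|^\beta e^{v/2}$ on $\partial\mathbb R^2_+$, satisfies $\mathrm{ind}(v)\ge1$; moreover, if $\int_{\mathbb R^2_+}|x|^{2\beta}e^v=\infty$ then $\mathrm{ind}(v)=\infty$.
   Context: $\mathbb R^2_+=\{(s,t)\in\mathbb R^2:t\ge0\}$, $\nu$ the outward normal on $\partial\mathbb R^2_+$. Solutions are classical solutions smooth away from the origin with $|x|^{2\alpha}e^v$ (resp. $|x|^{2\beta}e^v$) locally integrable. For (1): $\mathcal Q_v[\phi,\phi]=\int_{\mathbb R^2}\left(|\nabla\phi|^2-2K_0|x|^{2\alpha}e^v\phi^2\right)$ and $\mathrm{ind}(v)=\sup\{\dim E:\ E\subset C^\infty_c(\mathbb R^2),\ \mathcal Q_v[\phi,\phi]<0\ \forall\phi\in E\setminus\{0\}\}$. For (2): $\mathcal Q_v[\phi,\phi]=\int_{\mathbb R^2_+}\left(|\nabla\phi|^2-2K_0|x|^{2\beta}e^v\phi^2\right)-\int_{\partial\mathbb R^2_+}h_0|x|^\beta e^{v/2}\phi^2$ and $\mathrm{ind}(v)=\sup\{\dim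 E:\ E\subset C^\infty_c(\overline{\mathbb R^2_+}),\ \mathcal Q_v[\phi,\phi]<0\ \forall\phi\in E\setminus\{0\}\}$, where $C^\infty_c(\overline{\mathbb R^2_+})$ denotes smooth functions with compact support in the closed half-plane. *)

theory Defs
  imports "HOL-Analysis.Analysis" "HOL-Library.Extended_Nat"
begin

text \<open>C^k regularity on a set U (derivatives taken within U, so up to the boundary
  when U is not open): f is C^(k+1) iff it is differentiable at every point of U with
  partial derivatives g1, g2 which are themselves C^k on U.\<close>
fun Ck :: "nat \<Rightarrow> (real \<times> real) set \<Rightarrow> (real \<times> real \<Rightarrow> real) \<Rightarrow> bool" where
  "Ck 0 U f = continuous_on U f"
| "Ck (Suc k) U f =
     (\<exists>g1 g2. (\<forall>x\<in>U. (f has_derivative (\<lambda>h. fst h * g1 x + snd h * g2 x)) (at x within U))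
              \<and> Ck k U g1 \<and> Ck k U g2)"

definition smooth_on :: "(real \<times> real) set \<Rightarrow> (real \<times> real \<Rightarrow> real) \<Rightarrow> bool" where
  "smooth_on U f \<longleftrightarrow> (\<forall>k. Ck k U f)"

definition d1 :: "(real \<times> real \<Rightarrow> real) \<Rightarrow> real \<times> real \<Rightarrow> real" where
  "d1 f x = deriv (\<lambda>s. f (s, snd x)) (fst x)"

definition d2 :: "(real \<times> real \<Rightarrow> real) \<Rightarrow> real \<times> real \<Rightarrow> real" where
  "d2 f x = deriv (\<lambda>t. f (fst x, t)) (snd x)"

definition lap :: "(real \<times> real \<Rightarrow> real) \<Rightarrow> real \<times> real \<Rightarrow> real" where
  "lap f x = d1 (d1 f) x + d2 (d2 f) x"

definition upper_half :: "(real \<times> real) set" where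
  "upper_half = {x. snd x \<ge> 0}"

text \<open>Test functions: C^\<infinity> functions with compact support (restricted to the closed
  half-plane in case (2)).\<close>
definition test_fun :: "(real \<times> real \<Rightarrow> real) set" where
  "test_fun = {\<phi>. smooth_on UNIV \<phi> \<and> compact (closure {x. \<phi> x \<noteq> 0})}"

text \<open>Morse index: supremum of dim E over subspaces E of test functions on which Q is
  negative definite; E spanned by \<phi>_0..\<phi>_(n-1), negativity on E minus 0 means
  Q(sum c_i \<phi>_i) < 0 for every nonzero coefficient vector c (which also forces the
  \<phi>_i to be linearly independent, so dim E = n).\<close>
definition morse_index :: "((real \<times> real \<Rightarrow> real) \<Rightarrow> real) \<Rightarrow> enat" where
  "morse_index Q = (SUP n \<in> {n. \<exists>\<phi>::nat \<Rightarrow> real \<times> real \<Rightarrow> real.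
        (\<forall>i<n. \<phi> i \<in> test_fun) \<and>
        (\<forall>c::nat \<Rightarrow> real. (\<exists>i<n. c i \<noteq> 0) \<longrightarrow> Q (\<lambda>x. \<Sum>i<n. c i * \<phi> i x) < 0)}. enat n)"

definition Q_plane :: "real \<Rightarrow> real \<Rightarrow> (real \<times> real \<Rightarrow> real) \<Rightarrow> (real \<times> real \<Rightarrow> real) \<Rightarrow> real" where
  "Q_plane K0 \<alpha> v \<phi> =
     (LINT x|lborel. (d1 \<phi> x)\<^sup>2 + (d2 \<phi> x)\<^sup>2 - 2 * K0 * norm x powr (2*\<alpha>) * exp (v x) * (\<phi> x)\<^sup>2)"

definition Q_half :: "real \<Rightarrow> real \<Rightarrow> real \<Rightarrow> (real \<times> real \<Rightarrow> real) \<Rightarrow> (real \<times> real \<Rightarrow> real) \<Rightarrow> real" where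
  "Q_half K0 \<beta> h0 v \<phi> =
     (LINT x:upper_half|lborel. (d1 \<phi> x)\<^sup>2 + (d2 \<phi> x)\<^sup>2 - 2 * K0 * norm x powr (2*\<beta>) * exp (v x) * (\<phi> x)\<^sup>2)
     - (LINT s|lborel. h0 * \<bar>s\<bar> powr \<beta> * exp (v (s, 0) / 2) * (\<phi> (s, 0))\<^sup>2)"

definition sol_plane :: "real \<Rightarrow> real \<Rightarrow> (real \<times> real \<Rightarrow> real) \<Rightarrow> bool" where
  "sol_plane K0 \<alpha> v \<longleftrightarrow>
     smooth_on (UNIV - {0}) v \<and>
     (\<forall>x. x \<noteq> 0 \<longrightarrow> - lap v x = 2 * K0 * norm x powr (2*\<alpha>) * exp (v x)) \<and>
     (\<forall>K. compact K \<longrightarrow> set_integrable lborel K (\<lambda>x. norm x powr (2*\<alpha>) * exp (v x)))"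

text \<open>Solutions of (2): smooth up to the boundary away from the origin; equation in the
  open half-plane; boundary condition d_nu v = - d_t v = 2 h0 |x|^beta e^(v/2) on the
  boundary minus the origin; weight locally integrable on the closed half-plane.\<close>
definition sol_half :: "real \<Rightarrow> real \<Rightarrow> real \<Rightarrow> (real \<times> real \<Rightarrow> real) \<Rightarrow> bool" where
  "sol_half K0 \<beta> h0 v \<longleftrightarrow>
     smooth_on (upper_half - {0}) v \<and>
     (\<forall>s t. t > 0 \<longrightarrow> - lap v (s, t) = 2 * K0 * norm (s, t) powr (2*\<beta>) * exp (v (s, t))) \<and>
     (\<forall>s. s \<noteq> 0 \<longrightarrow>
        ((\<lambda>t. v (s, t)) has_real_derivative (- (2 * h0 * \<bar>s\<bar> powr \<beta> * exp (v (s, 0) / 2)))) (at_right 0)) \<and>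
     (\<forall>K. compact K \<longrightarrow>
        set_integrable lborel (K \<inter> upper_half) (\<lambda>x. norm x powr (2*\<beta>) * exp (v x)))"

end

theory Submission
  imports Defs
begin

text \<open>In the plane, logarithmic cutoffs \<open>\<eta>\<close> have arbitrarily small Dirichlet energy, so they already
  make the form negative. In the half-plane the boundary term has no sign. Put
  \<open>w = v / 2 + (\<beta> + 1) ln |x|\<close>, which still satisfies \<open>- \<Delta>w = K0 |x|\<^sup>2\<^sup>\<beta> e\<^sup>v\<close> away from
  the origin and has the normal derivative \<open>h0 |x|\<^sup>\<beta> e\<^sup>v\<^sup>/\<^sup>2\<close>, because \<open>ln |x|\<close> is harmonic with
  vanishing normal derivative on the boundary. Testing the form with \<open>p = e\<^sup>w \<eta>\<^sup>2\<close> and using the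
  divergence theorem for \<open>p\<^sup>2 \<nabla>w\<close> cancels the boundary term exactly. With \<open>W = |x|\<^sup>2\<^sup>\<beta> e\<^sup>v\<close> one gets
  \<open>Q(p) \<le> (8 / K0) \<integral>|x|\<^sup>2 |\<nabla>\<eta>|\<^sup>4 - (K0 / 2) \<integral>|x|\<^sup>2 W\<^sup>2 \<eta>\<^sup>4\<close>.
  For a cutoff with logarithmic transition length \<open>N\<close> the first integral is \<open>O(N\<^sup>-\<^sup>3)\<close>. Hence either \<open>Q\<close>
  is negative on some function supported in a given annulus of logarithmic width about \<open>3 N\<close>, or, by the
  Cauchy-Schwarz inequality, \<open>W\<close> has mass \<open>O(1 / N)\<close> on its middle third. Letting \<open>N\<close> grow around
  a fixed annulus gives index at least one; dyadic \<open>N\<close> at a fixed inner radius shows that an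
  infinite mass yields negative test functions arbitrarily far out. Test functions supported in
  disjoint annuli are orthogonal for \<open>Q\<close>, so the index is then infinite.\<close>

subsection \<open>Calculus of \<open>C\<^sup>k\<close> functions\<close>

text \<open>Relative to the cylinder metric \<open>|dx|^2 / |x|^2\<close>, the metric
  \<open>|x|^(2 \<beta>) e^v |dx|^2\<close> has conformal factor \<open>e^(2 w)\<close>; this is
  where \<open>w\<close> and the coefficient \<open>\<beta> + 1\<close> come from. Every multiple of
  \<open>ln |x|\<close> would preserve the cancellation at the boundary, but only this one gives
  \<open>e^(2 w) = |x|^2 W\<close>. What remains of the form is then \<open>|x|^2\<close> times a
  quadratic expression in \<open>W \<eta>^2\<close> and \<open>|grad \<eta>|^2\<close>, which
  completing a square separates. The square in \<open>\<eta>^2\<close> serves the same end: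
  \<open>|grad (\<eta>^2)|^2 = 4 \<eta>^2 |grad \<eta>|^2\<close> supplies the factor
  \<open>\<eta>^2\<close> that goes with \<open>W\<close>. The resulting integral of
  \<open>|x|^2 |grad \<eta>|^4\<close> is dilation invariant, so logarithmic cutoffs make it small
  at every radius. A bare cutoff does not suffice in the half-plane: for \<open>h0 < 0\<close> the
  boundary term is a positive contribution that the Dirichlet energy of the cutoff does not control.
  All test functions live in closed annuli, so the singularity at the origin never enters an
  integration by parts.\<close>

lemma Ck_SucI:
  assumes "\<And>x. x \<in> U \<Longrightarrow> (f has_derivative (\<lambda>h. fst h * g1 x + snd h * g2 x)) (at x within U)"
    and "Ck k U g1" "Ck k U g2"
  shows "Ck (Suc k) U f"
  unfolding Ck.simps using assms by (intro exI[of _ g1] exI[of _ g2]) simp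

lemma Ck_cong:
  assumes "Ck k U f" and "\<And>x. x \<in> U \<Longrightarrow> f x = g x"
  shows "Ck k U g"
proof (cases k)
  case 0
  then show ?thesis using assms continuous_on_cong by (metis Ck.simps(1))
next
  case (Suc m)
  with assms(1) obtain g1 g2 where g:
    "\<forall>x\<in>U. (f has_derivative (\<lambda>h. fst h * g1 x + snd h * g2 x)) (at x within U)"
    "Ck m U g1" "Ck m U g2" by auto
  have "\<forall>x\<in>U. (g has_derivative (\<lambda>h. fst h * g1 x + snd h * g2 x)) (at x within U)"
    
  proof
    fix x assume "x \<in> U"
    with g(1) assms(2) show "(g has_derivative (\<lambda>h. fst h * g1 x + snd h * g2 x)) (at x within U)"
      by (intro has_derivative_transform[of x U g f]) auto
  qed
  with g show ?thesis unfolding Suc Ck.simps by blast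
qed

lemma Ck_subset: "Ck k U f \<Longrightarrow> V \<subseteq> U \<Longrightarrow> Ck k V f"
proof (induction k arbitrary: f)
  case 0
  then show ?case using continuous_on_subset by auto
next
  case (Suc k)
  then show ?case unfolding Ck.simps by (meson has_derivative_subset subsetD)
qed

lemma Ck_Suc_D: "Ck (Suc k) U f \<Longrightarrow> Ck k U f"
proof (induction k arbitrary: f)
  case 0
  then show ?case
    by (auto simp: continuous_on_eq_continuous_within intro: has_derivative_continuous)
next
  case (Suc k)
  from Suc.prems obtain g1 g2 where
    "\<forall>x\<in>U. (f has_derivative (\<lambda>h. fst h * g1 x + snd h * g2 x)) (at x within U)"
    "Ck (Suc k) U g1" "Ck (Suc k) U g2" by (subst (asm) Ck.simps) blast
  then show ?case using Suc.IH unfolding Ck.simps(2)[of k U f] by blast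
qed

lemma Ck_imp_continuous: "Ck k U f \<Longrightarrow> continuous_on U f"
proof (induction k)
  case (Suc k)
  then show ?case using Ck_Suc_D by blast
qed auto

lemma Ck_const [simp]: "Ck k U (\<lambda>x. c)"
proof (induction k arbitrary: c)
  case (Suc k)
  have "\<forall>x\<in>U. ((\<lambda>x. c) has_derivative (\<lambda>h. fst h * 0 + snd h * 0)) (at x within U)" by auto
  then show ?case unfolding Ck.simps using Suc.IH by (intro exI[of _ "\<lambda>_. 0"]) simp
qed auto

lemma Ck_fst [simp]: "Ck k U fst"
proof (cases k)
  case (Suc m)
  have "\<forall>x\<in>U. (fst has_derivative (\<lambda>h. fst h * 1 + snd h * 0)) (at x within U)"
    by (auto intro!: derivative_eq_intros)
  then show ?thesis unfolding Suc Ck.simps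
    by (intro exI[of _ "\<lambda>_. 1"] exI[of _ "\<lambda>_. 0"]) simp
qed (auto intro: continuous_intros)

lemma Ck_snd [simp]: "Ck k U snd"
proof (cases k)
  case (Suc m)
  have "\<forall>x\<in>U. (snd has_derivative (\<lambda>h. fst h * 0 + snd h * 1)) (at x within U)"
    by (auto intro!: derivative_eq_intros)
  then show ?thesis unfolding Suc Ck.simps
    by (intro exI[of _ "\<lambda>_. 0"] exI[of _ "\<lambda>_. 1"]) simp
qed (auto intro: continuous_intros)

lemma Ck_add: "Ck k U f \<Longrightarrow> Ck k U g \<Longrightarrow> Ck k U (\<lambda>x. f x + g x)"
proof (induction k arbitrary: f g)
  case 0
  then show ?case by (auto intro: continuous_intros)
next
  case (Suc k)
  obtain f1 f2 where f: "\<forall>x\<in>U. (f has_derivative (\<lambda>h. fst h * f1 x + snd h * f2 x)) (at x within U)"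
    "Ck k U f1" "Ck k U f2" using Suc.prems(1) by auto
  obtain g1 g2 where g: "\<forall>x\<in>U. (g has_derivative (\<lambda>h. fst h * g1 x + snd h * g2 x)) (at x within U)"
    "Ck k U g1" "Ck k U g2" using Suc.prems(2) by auto
  have "\<forall>x\<in>U. ((\<lambda>x. f x + g x) has_derivative (\<lambda>h. fst h * (f1 x + g1 x) + snd h * (f2 x + g2 x))) (at x within U)"
    using f g by (auto intro!: derivative_eq_intros simp: algebra_simps)
  then show ?case unfolding Ck.simps(2)
    using Suc.IH[OF f(2) g(2)] Suc.IH[OF f(3) g(3)] 
    by (intro exI[of _ "\<lambda>x. f1 x + g1 x"] exI[of _ "\<lambda>x. f2 x + g2 x"]) simp
qed

lemma Ck_mult: "Ck k U f \<Longrightarrow> Ck k U g \<Longrightarrow> Ck k U (\<lambda>x. f x * g x)"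
proof (induction k arbitrary: f g)
  case 0
  then show ?case by (auto intro: continuous_intros)
next
  case (Suc k)
  obtain f1 f2 where f: "\<forall>x\<in>U. (f has_derivative (\<lambda>h. fst h * f1 x + snd h * f2 x)) (at x within U)"
    "Ck k U f1" "Ck k U f2" using Suc.prems(1) by auto
  obtain g1 g2 where g: "\<forall>x\<in>U. (g has_derivative (\<lambda>h. fst h * g1 x + snd h * g2 x)) (at x within U)"
    "Ck k U g1" "Ck k U g2" using Suc.prems(2) by auto
  note fk = Ck_Suc_D[OF Suc.prems(1)] and gk = Ck_Suc_D[OF Suc.prems(2)]
  have "\<forall>x\<in>U. ((\<lambda>x. f x * g x) has_derivative 
      (\<lambda>h. fst h * (f1 x * g x + f x * g1 x) + snd h * (f2 x * g x + f x * g2 x))) (at x within U)"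
    using f g by (auto intro!: derivative_eq_intros simp: algebra_simps)
  moreover have "Ck k U (\<lambda>x. f1 x * g x + f x * g1 x)" "Ck k U (\<lambda>x. f2 x * g x + f x * g2 x)"
    using Suc.IH f g fk gk by (auto intro!: Ck_add)
  ultimately show ?case by (intro Ck_SucI) (assumption | blast)+
qed

text \<open>The outer function is given together with all its derivatives \<open>h n\<close>: the
  chain rule turns \<open>h n\<close> into \<open>h (Suc n)\<close>, so the induction on
  \<open>k\<close> closes once \<open>n\<close> is generalised.\<close>

lemma Ck_compose:
  fixes h :: "nat \<Rightarrow> real \<Rightarrow> real"
  assumes "\<And>n y. y \<in> D \<Longrightarrow> (h n has_real_derivative h (Suc n) y) (at y)"
    and "\<And>x. x \<in> U \<Longrightarrow> f x \<in> D"
  shows "Ck k U f \<Longrightarrow> Ck k U (\<lambda>x. h n (f x))"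
proof (induction k arbitrary: n)
  case 0
  have "continuous_on D (h n)"
    using assms(1) by (meson DERIV_isCont continuous_at_imp_continuous_on)
  then show ?case
    using 0 assms(2) by (auto intro: continuous_on_compose2[of D "h n" U f])
next
  case (Suc k)
  obtain f1 f2 where f: "\<forall>x\<in>U. (f has_derivative (\<lambda>h. fst h * f1 x + snd h * f2 x)) (at x within U)"
    "Ck k U f1" "Ck k U f2" using Suc.prems(1) by auto
  have "((\<lambda>x. h n (f x)) has_derivative 
      (\<lambda>v. fst v * (h (Suc n) (f x) * f1 x) + snd v * (h (Suc n) (f x) * f2 x))) (at x within U)"
    if "x \<in> U" for x
  proof -
    have "(h n has_derivative (\<lambda>z. h (Suc n) (f x) * z)) (at (f x))"
      using assms that by (simp add: has_field_derivative_def)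
    from has_derivative_compose[OF f(1)[rule_format, OF that] this]
    show ?thesis by (simp add: algebra_simps)
  qed
  moreover have "Ck k U (\<lambda>x. h (Suc n) (f x) * f1 x)" "Ck k U (\<lambda>x. h (Suc n) (f x) * f2 x)"
    using Suc.IH Ck_Suc_D[OF Suc.prems] f by (auto intro!: Ck_mult)
  ultimately show ?case by (intro Ck_SucI) (assumption | blast)+
qed

lemma Ck_exp: "Ck k U f \<Longrightarrow> Ck k U (\<lambda>x. exp (f x))"
  by (rule Ck_compose[where h = "\<lambda>_. exp" and D = UNIV]) (auto intro: derivative_eq_intros)

lemma Ck_inverse:
  assumes "Ck k U f" "\<And>x. x \<in> U \<Longrightarrow> f x > 0"
  shows "Ck k U (\<lambda>x. inverse (f x))"
proof -
  \<comment> \<open>The \<open>n\<close>-th derivative of \<open>1 / y\<close>.\<close>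
  define h :: "nat \<Rightarrow> real \<Rightarrow> real" where "h n y = (-1)^n * fact n * inverse y ^ Suc n" for n y
  have "(h n has_real_derivative h (Suc n) y) (at y)" if "y \<in> {0<..}" for n y
  proof -
    have "(inverse has_real_derivative - (inverse y * inverse y)) (at y)"
      using DERIV_inverse[of y] that by (simp add: power2_eq_square)
    from DERIV_cmult[OF DERIV_power[OF this, of "Suc n"], of "(-1)^n * fact n"]
    show ?thesis by (simp add: h_def[abs_def] algebra_simps)
  qed
  then have "Ck k U (\<lambda>x. h 0 (f x))"
    using assms by (intro Ck_compose[where h = h and D = "{0<..}"]) auto
  then show ?thesis by (simp add: h_def)
qed

lemma Ck_ln:
  assumes "Ck k U f" "\<And>x. x \<in> U \<Longrightarrow> f x > 0"
  shows "Ck k U (\<lambda>x. ln (f x))"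
proof (cases k)
  case 0
  with assms show ?thesis by (force intro!: continuous_on_ln)
next
  case (Suc m)
  with assms(1) obtain f1 f2 where f: "\<forall>x\<in>U. (f has_derivative (\<lambda>h. fst h * f1 x + snd h * f2 x)) (at x within U)"
    "Ck m U f1" "Ck m U f2" by auto
  have "Ck m U (\<lambda>x. inverse (f x))"
    using Ck_inverse assms Ck_Suc_D Suc by blast
  then have "Ck m U (\<lambda>x. inverse (f x) * f1 x)" "Ck m U (\<lambda>x. inverse (f x) * f2 x)"
    using f by (auto intro: Ck_mult)
  moreover have "((\<lambda>x. ln (f x)) has_derivative
      (\<lambda>h. fst h * (inverse (f x) * f1 x) + snd h * (inverse (f x) * f2 x))) (at x within U)" if "x \<in> U" for x
    using that f(1) assms(2)[OF that]
    by (auto intro!: derivative_eq_intros simp: algebra_simps)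
  ultimately show ?thesis unfolding Suc by (intro Ck_SucI) (assumption | blast)+
qed

lemma Ck_shift: "Ck k U f \<Longrightarrow> Ck k {x. x + c \<in> U} (\<lambda>x. f (x + c))"
proof (induction k arbitrary: f)
  case 0
  then show ?case
    by (auto intro!: continuous_on_compose2[of U f] continuous_intros)
next
  case (Suc k)
  obtain f1 f2 where f: "\<forall>x\<in>U. (f has_derivative (\<lambda>h. fst h * f1 x + snd h * f2 x)) (at x within U)"
    "Ck k U f1" "Ck k U f2" using Suc.prems(1) by auto
  have "((\<lambda>x. f (x + c)) has_derivative (\<lambda>h. fst h * f1 (x + c) + snd h * f2 (x + c))) (at x within {x. x + c \<in> U})"
    if "x + c \<in> U" for x
  proof -
    have s: "((\<lambda>x. x + c) has_derivative (\<lambda>h. h)) (at x within {x. x + c \<in> U})"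
      by (auto intro!: derivative_eq_intros)
    have "(f has_derivative (\<lambda>h. fst h * f1 (x + c) + snd h * f2 (x + c))) (at (x + c) within ((\<lambda>x. x + c) ` {x. x + c \<in> U}))"
      by (rule has_derivative_subset[OF f(1)[rule_format, OF that]]) auto
    from has_derivative_in_compose[OF s this] show ?thesis by simp
  qed
  then show ?case unfolding Ck.simps(2) using Suc.IH f
    by (intro exI[of _ "\<lambda>x. f1 (x + c)"] exI[of _ "\<lambda>x. f2 (x + c)"]) simp
qed

section \<open>Gluing on open sets, and the link to the pointwise partials\<close>

lemma has_derivative_components_unique:
  assumes "(f has_derivative (\<lambda>h. fst h * a + snd h * b)) (at x)"
    and "(f has_derivative (\<lambda>h. fst h * c + snd h * d)) (at x)"
  shows "a = (c::real)" "b = (d::real)"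
proof -
  have "(\<lambda>h::real\<times>real. fst h * a + snd h * b) = (\<lambda>h. fst h * c + snd h * d)"
    using assms by (rule has_derivative_unique)
  from fun_cong[OF this, of "(1,0)"] fun_cong[OF this, of "(0,1)"] show "a = c" "b = d" by auto
qed

text \<open>\<open>Ck\<close> only asserts that some partials exist, possibly different ones on
  \<open>U\<close> and on \<open>V\<close>. On open sets the derivative is unique, so the two
  choices agree on the overlap and can be pasted. This is what allows extensions by zero.\<close>

lemma Ck_Un_open:
  assumes "open U" "open V"
  shows "Ck k U f \<Longrightarrow> Ck k V f \<Longrightarrow> Ck k (U \<union> V) f"
proof (induction k arbitrary: f)
  case 0
  then show ?case using assms continuous_on_open_Un by auto
next
  case (Suc k)
  obtain f1 f2 where f: "\<forall>x\<in>U. (f has_derivative (\<lambda>h. fst h * f1 x + snd h * f2 x)) (at x within U)"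
    "Ck k U f1" "Ck k U f2" using Suc.prems(1) by auto
  obtain g1 g2 where g: "\<forall>x\<in>V. (f has_derivative (\<lambda>h. fst h * g1 x + snd h * g2 x)) (at x within V)"
    "Ck k V g1" "Ck k V g2" using Suc.prems(2) by auto
  have f': "(f has_derivative (\<lambda>h. fst h * f1 x + snd h * f2 x)) (at x)" if "x \<in> U" for x
    using f(1) that assms(1) by (metis at_within_open)
  have g': "(f has_derivative (\<lambda>h. fst h * g1 x + snd h * g2 x)) (at x)" if "x \<in> V" for x
    using g(1) that assms(2) by (metis at_within_open)
  define p1 where "p1 x = (if x \<in> U then f1 x else g1 x)" for x
  define p2 where "p2 x = (if x \<in> U then f2 x else g2 x)" for x
  have pV: "p1 x = g1 x" "p2 x = g2 x" if "x \<in> V" for x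
    using that has_derivative_components_unique[OF f' g', of x] by (auto simp: p1_def p2_def)
  have "Ck k (U \<union> V) p1" "Ck k (U \<union> V) p2"
    using f(2,3) g(2,3) pV by (auto intro!: Suc.IH intro: Ck_cong simp: p1_def p2_def)
  moreover have "\<forall>x\<in>U \<union> V. (f has_derivative (\<lambda>h. fst h * p1 x + snd h * p2 x)) (at x within U \<union> V)"
    using f' g' pV by (auto simp: p1_def p2_def intro: has_derivative_at_withinI)
  ultimately show ?case by (intro Ck_SucI) (assumption | blast)+
qed

text \<open>\<open>d1\<close> and \<open>d2\<close> are defined by \<open>deriv\<close> along
  coordinate lines; all later evaluations of them go through a total derivative and this
  lemma.\<close>

lemma d1_d2_eq:
  assumes "(f has_derivative (\<lambda>h. fst h * a + snd h * b)) (at x)"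
  shows "d1 f x = a" "d2 f x = b"
proof -
  have f: "(f has_derivative (\<lambda>h. fst h * a + snd h * b)) (at (fst x, snd x))" using assms by simp
  have "((\<lambda>s. (s, snd x)) has_derivative (\<lambda>h. (h, 0))) (at (fst x))"
    by (auto intro!: derivative_eq_intros)
  from has_derivative_compose[OF this f] have "((\<lambda>s. f (s, snd x)) has_real_derivative a) (at (fst x))"
    by (simp add: has_field_derivative_def mult_commute_abs)
  then show "d1 f x = a" unfolding d1_def by (rule DERIV_imp_deriv)
  have "((\<lambda>t. (fst x, t)) has_derivative (\<lambda>h. (0, h))) (at (snd x))"
    by (auto intro!: derivative_eq_intros)
  from has_derivative_compose[OF this f] have "((\<lambda>t. f (fst x, t)) has_real_derivative b) (at (snd x))"
    by (simp add: has_field_derivative_def mult_commute_abs)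
  then show "d2 f x = b" unfolding d2_def by (rule DERIV_imp_deriv)
qed

lemma smooth_C1:
  assumes "smooth_on UNIV \<phi>"
  shows "(\<phi> has_derivative (\<lambda>h. fst h * d1 \<phi> x + snd h * d2 \<phi> x)) (at x)"
    "continuous_on UNIV \<phi>" "continuous_on UNIV (d1 \<phi>)" "continuous_on UNIV (d2 \<phi>)"
proof -
  have "Ck (Suc 0) UNIV \<phi>" using assms by (auto simp: smooth_on_def)
  then obtain g1 g2 where g: "\<And>x. (\<phi> has_derivative (\<lambda>h. fst h * g1 x + snd h * g2 x)) (at x)"
    "continuous_on UNIV g1" "continuous_on UNIV g2" by auto
  have "d1 \<phi> = g1" "d2 \<phi> = g2" using d1_d2_eq[OF g(1)] by auto
  with g show "(\<phi> has_derivative (\<lambda>h. fst h * d1 \<phi> x + snd h * d2 \<phi> x)) (at x)"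
     "continuous_on UNIV (d1 \<phi>)" "continuous_on UNIV (d2 \<phi>)" by auto
  show "continuous_on UNIV \<phi>" using assms Ck_imp_continuous by (auto simp: smooth_on_def)
qed

subsection \<open>Logarithmic cutoff functions\<close>

text \<open>The classical \<open>exp (- 1 / y)\<close>, multiplied by powers of
  \<open>1 / y\<close>. The powers make the family closed under differentiation up to linear
  combinations, so smoothness follows by an induction over all \<open>n\<close> at once.\<close>

definition flat :: "nat \<Rightarrow> real \<Rightarrow> real" where
  "flat n y = (if y > 0 then inverse y ^ n * exp (- inverse y) else 0)"

lemma flat_nonpos [simp]: "y \<le> 0 \<Longrightarrow> flat n y = 0"
  by (simp add: flat_def)

lemma flat_nonneg: "flat n y \<ge> 0"
  by (simp add: flat_def)

lemma flat_pos: "y > 0 \<Longrightarrow> flat n y > 0"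
  by (simp add: flat_def)

lemma flat_tendsto_0: "(flat n \<longlongrightarrow> 0) (at 0)"
proof (rule filterlim_split_at)
  show "(flat n \<longlongrightarrow> 0) (at_left 0)"
    by (rule tendsto_eventually) (auto simp: eventually_at_filter flat_def)
  have "((\<lambda>y. inverse y ^ n / exp (inverse y)) \<longlongrightarrow> 0) (at_right (0::real))"
    by (rule filterlim_compose[OF tendsto_power_div_exp_0 filterlim_inverse_at_top_right])
  then show "(flat n \<longlongrightarrow> 0) (at_right 0)"
    by (rule Lim_transform_eventually) (auto simp: eventually_at_filter flat_def exp_minus divide_inverse)
qed

lemma DERIV_flat:
  "(flat n has_real_derivative flat (n + 2) y - real n * flat (n + 1) y) (at y)"
proof -
  consider "y > 0" | "y = 0" | "y < 0" by linarith
  then show ?thesis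
  proof cases
    case 1
    have i: "(inverse has_real_derivative - (inverse y * inverse y)) (at y)"
      using DERIV_inverse[of y] 1 by (simp add: power2_eq_square)
    have pw: "((\<lambda>y. inverse y ^ n) has_real_derivative - (real n * inverse y ^ (n + 1))) (at y)"
      using DERIV_power[OF i, of n] by (cases n) (auto simp: algebra_simps)
    have "((\<lambda>y. exp (- inverse y)) has_real_derivative exp (- inverse y) * (inverse y * inverse y)) (at y)"
      using DERIV_chain2[OF DERIV_exp DERIV_minus[OF i]] by simp
    from DERIV_mult[OF pw this]
    have "((\<lambda>y. inverse y ^ n * exp (- inverse y)) has_real_derivative 
        flat (n + 2) y - real n * flat (n + 1) y) (at y)"
      using 1 by (simp add: flat_def algebra_simps)
    then show ?thesis
      by (rule has_field_derivative_transform_within_open[where S = "{0<..}"]) (use 1 in \<open>auto simp: flat_def\<close>)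
  next
    case 2
    \<comment> \<open>The difference quotient of \<open>flat n\<close> at 0 is exactly
      \<open>flat (Suc n)\<close>.\<close>
    have "((\<lambda>h. (flat n (0 + h) - flat n 0) / h) \<longlongrightarrow> 0) (at 0)"
      by (rule Lim_transform_eventually[OF flat_tendsto_0[of "Suc n"]])
         (auto simp: eventually_at_filter flat_def field_simps)
    then show ?thesis using 2 by (simp add: DERIV_def)
  next
    case 3
    have "((\<lambda>_. 0) has_real_derivative 0) (at y)" by simp
    then have "(flat n has_real_derivative 0) (at y)"
      by (rule has_field_derivative_transform_within_open[where S = "{..<0}"]) (use 3 in \<open>auto simp: flat_def\<close>)
    then show ?thesis using 3 by simp
  qed
qed

lemma continuous_on_flat: "continuous_on S (flat n)"
  using DERIV_flat by (meson DERIV_isCont continuous_at_imp_continuous_on)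

lemma Ck_flat: "Ck k U f \<Longrightarrow> Ck k U (\<lambda>x. flat n (f x))"
proof (induction k arbitrary: n)
  case 0
  then show ?case by (auto intro: continuous_on_compose2[OF continuous_on_flat[of UNIV]])
next
  case (Suc k)
  obtain f1 f2 where f: "\<forall>x\<in>U. (f has_derivative (\<lambda>h. fst h * f1 x + snd h * f2 x)) (at x within U)"
    "Ck k U f1" "Ck k U f2" using Suc.prems(1) by auto
  let ?F = "\<lambda>x. flat (n + 2) (f x) + (- real n) * flat (n + 1) (f x)"
  have "((\<lambda>x. flat n (f x)) has_derivative 
      (\<lambda>v. fst v * (?F x * f1 x) + snd v * (?F x * f2 x))) (at x within U)"
    if "x \<in> U" for x
  proof -
    have "(flat n has_derivative (\<lambda>z. ?F x * z)) (at (f x))"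
      using DERIV_flat[of n "f x"] by (simp add: has_field_derivative_def)
    from has_derivative_compose[OF f(1)[rule_format, OF that] this]
    show ?thesis by (simp add: algebra_simps)
  qed
  moreover have "Ck k U (\<lambda>x. ?F x * f1 x)" "Ck k U (\<lambda>x. ?F x * f2 x)"
    by (intro Ck_mult Ck_add Ck_const Suc.IH Ck_Suc_D[OF Suc.prems] f)+
  ultimately show ?case by (intro Ck_SucI) (assumption | blast)+
qed

definition smooth_step :: "real \<Rightarrow> real" where
  "smooth_step y = flat 0 y / (flat 0 y + flat 0 (1 - y))"

definition smooth_step' :: "real \<Rightarrow> real" where
  "smooth_step' y = (flat 2 y * flat 0 (1 - y) + flat 0 y * flat 2 (1 - y)) / (flat 0 y + flat 0 (1 - y))\<^sup>2"

lemma smooth_step_denom: "flat 0 y + flat 0 (1 - y) > 0"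
proof (cases "y > 0")
  case True
  then show ?thesis using flat_pos flat_nonneg by (meson add_pos_nonneg)
next
  case False
  then have "1 - y > 0" by simp
  then show ?thesis using flat_pos flat_nonneg by (meson add_nonneg_pos)
qed

lemma smooth_step_simps [simp]:
  "y \<le> 0 \<Longrightarrow> smooth_step y = 0" "y \<ge> 1 \<Longrightarrow> smooth_step y = 1"
  "y \<le> 0 \<Longrightarrow> smooth_step' y = 0" "y \<ge> 1 \<Longrightarrow> smooth_step' y = 0"
  using smooth_step_denom[of y] by (auto simp: smooth_step_def smooth_step'_def)

lemma smooth_step_range: "0 \<le> smooth_step y" "smooth_step y \<le> 1"
  using smooth_step_denom[of y] flat_nonneg[of 0 y] flat_nonneg[of 0 "1 - y"]
  by (auto simp: smooth_step_def divide_simps)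

lemma DERIV_smooth_step: "(smooth_step has_real_derivative smooth_step' y) (at y)"
proof -
  have f: "(flat 0 has_real_derivative flat 2 y) (at y)" for y
    using DERIV_flat[of 0 y] by (simp add: numeral_2_eq_2)
  have g: "((\<lambda>y. flat 0 (1 - y)) has_real_derivative - flat 2 (1 - y)) (at y)"
    using DERIV_chain2[OF f, of "\<lambda>y. 1 - y" "-1" y UNIV] DERIV_diff[OF DERIV_const DERIV_ident, of 1 y UNIV] by simp
  show ?thesis
    unfolding smooth_step_def[abs_def] smooth_step'_def
    using smooth_step_denom[of y]
    by (auto intro!: derivative_eq_intros f g simp: divide_simps power2_eq_square algebra_simps)
qed

lemma continuous_smooth_step': "continuous_on S smooth_step'"
proof -
  have "continuous_on S (\<lambda>y. flat n (1 - y))" for n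
    by (rule continuous_on_compose2[OF continuous_on_flat[of UNIV]]) (auto intro: continuous_intros)
  moreover have "(flat 0 y + flat 0 (1 - y))\<^sup>2 \<noteq> 0" for y
    using smooth_step_denom[of y] by simp
  ultimately show ?thesis unfolding smooth_step'_def[abs_def]
    by (intro continuous_intros continuous_on_flat) auto
qed

lemma smooth_step'_bounded: "\<exists>M>0. \<forall>y. \<bar>smooth_step' y\<bar> \<le> M"
proof -
  have "compact (smooth_step' ` {0..1})"
    by (intro compact_continuous_image continuous_smooth_step') simp
  then obtain M where M: "\<And>y. y \<in> {0..1} \<Longrightarrow> \<bar>smooth_step' y\<bar> \<le> M"
    by (metis compact_imp_bounded bounded_iff imageI real_norm_def)
  have "\<bar>smooth_step' y\<bar> \<le> max M 1" for y
    using M[of y] by (cases "y \<in> {0..1}") auto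
  then show ?thesis by (metis max.strict_coboundedI2 zero_less_one)
qed

lemma Ck_smooth_step: "Ck k U f \<Longrightarrow> Ck k U (\<lambda>x. smooth_step (f x))"
proof -
  assume f: "Ck k U f"
  have "Ck k U (\<lambda>x. 1 + (-1) * f x)" using f by (intro Ck_add Ck_mult Ck_const)
  then have "Ck k U (\<lambda>x. 1 - f x)" by simp
  with f have "Ck k U (\<lambda>x. flat 0 (f x) * inverse (flat 0 (f x) + flat 0 (1 - f x)))"
    by (intro Ck_mult Ck_inverse Ck_add Ck_flat smooth_step_denom) 
  then show ?thesis by (simp add: smooth_step_def divide_inverse)
qed

text \<open>The parameters are logarithms of radii, so that dilations become translations of
  \<open>a\<close> and \<open>b\<close>, and \<open>b - a\<close> is the dilation invariant
  width.\<close>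

definition annulus :: "real \<Rightarrow> real \<Rightarrow> (real \<times> real) set" where
  "annulus a b = {x. exp a \<le> norm x \<and> norm x \<le> exp b}"

section \<open>Radial cutoffs in the variable \<open>ln |x|\<close>\<close>

lemma norm_sq: "(norm x)\<^sup>2 = (fst x)\<^sup>2 + (snd x :: real)\<^sup>2" for x :: "real \<times> real"
  by (simp add: norm_prod_def)

lemma has_derivative_ln_norm:
  fixes x :: "real \<times> real"
  assumes "x \<noteq> 0"
  shows "((\<lambda>x. ln (norm x)) has_derivative 
    (\<lambda>h. fst h * (fst x / (norm x)\<^sup>2) + snd h * (snd x / (norm x)\<^sup>2))) (at x within S)"
proof -
  have pos: "(fst x)\<^sup>2 + (snd x)\<^sup>2 > 0"
    using assms by (metis norm_sq zero_less_norm_iff zero_less_power)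
  have eq: "ln (norm y) = ln ((fst y)\<^sup>2 + (snd y)\<^sup>2) / 2" for y :: "real \<times> real"
    by (cases "y = 0") (auto simp: norm_sq[symmetric] ln_realpow)
  show ?thesis
    unfolding eq norm_sq using pos
    by (auto intro!: derivative_eq_intros ext simp: divide_simps) (auto simp: algebra_simps)
qed

lemma Ck_ln_norm: "0 \<notin> U \<Longrightarrow> Ck k U (\<lambda>x. ln (norm x))"
proof -
  assume U: "0 \<notin> U"
  have pos: "fst x * fst x + snd x * snd x > 0" if "x \<in> U" for x
    using that U by (metis norm_sq power2_eq_square zero_less_norm_iff zero_less_power)
  have "Ck k U (\<lambda>x. (1 / 2) * ln (fst x * fst x + snd x * snd x))"
    using pos by (intro Ck_mult Ck_ln Ck_add Ck_const Ck_fst Ck_snd)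
  moreover have "(1 / 2) * ln (fst x * fst x + snd x * snd x) = ln (norm x)" if "x \<in> U" for x
    using pos[OF that] U that by (auto simp: norm_sq[symmetric] ln_realpow power2_eq_square[symmetric])
  ultimately show ?thesis by (rule Ck_cong)
qed

text \<open>A product of two smooth steps in \<open>ln |x|\<close>, one rising over length
  \<open>l\<close> at the inner end and one falling over length \<open>l\<close> at the outer end.
  The gradient of \<open>ln |x|\<close> has length \<open>1 / |x|\<close>, and each step contributes
  a factor \<open>1 / l\<close>; \<open>C\<close> is independent of the annulus.\<close>

lemma ex_log_cutoff:
  "\<exists>C>0. \<forall>a b l. l > 0 \<longrightarrow> a + 2 * l \<le> b \<longrightarrow> (\<exists>\<eta>. smooth_on UNIV \<eta> \<and>
     (\<forall>x. 0 \<le> \<eta> x \<and> \<eta> x \<le> 1) \<and> (\<forall>x. x \<notin> annulus a b \<longrightarrow> \<eta> x = 0) \<and>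
     (\<forall>x\<in>annulus (a + l) (b - l). \<eta> x = 1) \<and>
     (\<forall>x. (d1 \<eta> x)\<^sup>2 + (d2 \<eta> x)\<^sup>2 \<le> C / (l\<^sup>2 * (norm x)\<^sup>2)) \<and>
     (\<forall>x. x \<notin> annulus a (a + l) \<union> annulus (b - l) b \<longrightarrow> d1 \<eta> x = 0 \<and> d2 \<eta> x = 0))"
proof -
  obtain M where M: "M > 0" "\<And>y. \<bar>smooth_step' y\<bar> \<le> M" using smooth_step'_bounded by blast
  show ?thesis
  \<comment> \<open>The product rule produces two terms, each at most \<open>M / l\<close> in
    absolute value.\<close>
  proof (intro exI[of _ "(2 * M)\<^sup>2"] conjI allI impI)
    show "(2 * M)\<^sup>2 > 0" using M by simp
    fix a b l :: real assume l: "l > 0" and ab: "a + 2 * l \<le> b"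
    define p where "p x = (ln (norm x) - a) / l" for x :: "real \<times> real"
    define q where "q x = (b - ln (norm x)) / l" for x :: "real \<times> real"
    \<comment> \<open>At the origin the logarithm is only a default value, so \<open>p\<close> and
      \<open>q\<close> mean nothing there and the value 0 is imposed.\<close>
    define \<eta> where "\<eta> x = (if x = 0 then 0 else smooth_step (p x) * smooth_step (q x))" for x :: "real \<times> real"
    define D where "D x = (smooth_step' (p x) * smooth_step (q x) - smooth_step (p x) * smooth_step' (q x)) / l" for x
    have lnle: "ln (norm x) < c \<longleftrightarrow> norm x < exp c" "c < ln (norm x) \<longleftrightarrow> exp c < norm x" 
      if "x \<noteq> 0" for x :: "real \<times> real" and c
      using that exp_less_cancel_iff[of "ln (norm x)" c] exp_less_cancel_iff[of c "ln (norm x)"] by auto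
    have pq: "norm x < exp a \<Longrightarrow> p x < 0" "norm x > exp (a + l) \<Longrightarrow> p x > 1" 
      "norm x > exp b \<Longrightarrow> q x < 0" "norm x < exp (b - l) \<Longrightarrow> q x > 1" if "x \<noteq> 0" for x
      using l lnle(1)[OF that, of a] lnle(2)[OF that, of "a + l"] lnle(2)[OF that, of b] lnle(1)[OF that, of "b - l"]
      by (auto simp: p_def q_def divide_simps algebra_simps)
    have pq': "norm x \<ge> exp (a + l) \<Longrightarrow> p x \<ge> 1" "norm x \<le> exp (b - l) \<Longrightarrow> q x \<ge> 1" if "x \<noteq> 0" for x
      using l lnle(1)[OF that, of "a + l"] lnle(2)[OF that, of "b - l"]
      by (auto simp: p_def q_def divide_simps algebra_simps not_less[symmetric])
    have out: "\<eta> x = 0" if "x \<notin> annulus a b" for x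
      using that pq[of x] by (auto simp: \<eta>_def annulus_def not_le)
    have sm: "smooth_on UNIV \<eta>" unfolding smooth_on_def
    proof
      fix k
      have "Ck k (UNIV - {0}) (\<lambda>x. smooth_step (1 / l * ln (norm x) + (- a / l)) * smooth_step (- 1 / l * ln (norm x) + b / l))"
        by (intro Ck_mult Ck_smooth_step Ck_add Ck_const Ck_ln_norm) auto
      then have "Ck k (UNIV - {0}) \<eta>"
        by (rule Ck_cong) (auto simp: \<eta>_def p_def q_def diff_divide_distrib)
      moreover have "Ck k (ball 0 (exp a)) (\<lambda>x. 0)" by (rule Ck_const)
      then have "Ck k (ball 0 (exp a)) \<eta>"
        by (rule Ck_cong) (use out in \<open>auto simp: annulus_def\<close>)
      ultimately have "Ck k ((UNIV - {0}) \<union> ball 0 (exp a)) \<eta>"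
        by (intro Ck_Un_open) auto
      moreover have "(UNIV - {0}) \<union> ball 0 (exp a) = (UNIV :: (real \<times> real) set)" by auto
      ultimately show "Ck k UNIV \<eta>" by simp
    qed
    have der: "d1 \<eta> x = D x * (fst x / (norm x)\<^sup>2)" "d2 \<eta> x = D x * (snd x / (norm x)\<^sup>2)" if "x \<noteq> 0" for x
    proof -
      let ?L1 = "fst x / (norm x)\<^sup>2" and ?L2 = "snd x / (norm x)\<^sup>2"
      obtain L where L_def: "L = (\<lambda>x::real\<times>real. ln (norm x))" by simp
      have L: "(L has_derivative (\<lambda>h. fst h * ?L1 + snd h * ?L2)) (at x)"
        unfolding L_def using has_derivative_ln_norm[OF that] .
      have pqL: "p = (\<lambda>x. (L x - a) / l)" "q = (\<lambda>x. (b - L x) / l)"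
        by (auto simp: L_def p_def q_def)
      have S: "(smooth_step has_derivative (\<lambda>z. smooth_step' y * z)) (at y)" for y
        using DERIV_smooth_step by (simp add: has_field_derivative_def)
      have p: "(p has_derivative (\<lambda>h. (fst h * ?L1 + snd h * ?L2) / l)) (at x)"
        unfolding pqL using l by (auto intro!: derivative_eq_intros L)
      have q: "(q has_derivative (\<lambda>h. - (fst h * ?L1 + snd h * ?L2) / l)) (at x)"
        unfolding pqL using l by (auto intro!: derivative_eq_intros L)
      have "((\<lambda>x. smooth_step (p x) * smooth_step (q x)) has_derivative 
         (\<lambda>h. fst h * (D x * ?L1) + snd h * (D x * ?L2))) (at x)"
        using has_derivative_mult[OF has_derivative_compose[OF p S] has_derivative_compose[OF q S]]
        by (rule has_derivative_eq_rhs) (simp add: D_def fun_eq_iff diff_divide_distrib add_divide_distrib algebra_simps)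
      then have "(\<eta> has_derivative (\<lambda>h. fst h * (D x * ?L1) + snd h * (D x * ?L2))) (at x)"
        by (rule has_derivative_transform_within_open[where s = "UNIV - {0}"]) (use that in \<open>auto simp: \<eta>_def\<close>)
      from d1_d2_eq[OF this] show "d1 \<eta> x = D x * ?L1" "d2 \<eta> x = D x * ?L2" .
    qed
    have zero: "d1 \<eta> 0 = 0" "d2 \<eta> 0 = 0"
    proof -
      have "((\<lambda>_. 0) has_derivative (\<lambda>h. fst h * 0 + snd h * 0)) (at (0::real\<times>real))" by simp
      then have "(\<eta> has_derivative (\<lambda>h. fst h * 0 + snd h * 0)) (at 0)"
        by (rule has_derivative_transform_within_open[where s = "ball 0 (exp a)"]) 
           (use out in \<open>auto simp: annulus_def\<close>)
      from d1_d2_eq[OF this] show "d1 \<eta> 0 = 0" "d2 \<eta> 0 = 0" .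
    qed
    have Db: "\<bar>D x\<bar> \<le> 2 * M / l" for x
    proof -
      have "\<bar>smooth_step' y * smooth_step z\<bar> \<le> M" for y z
      proof -
        have "\<bar>smooth_step' y\<bar> * \<bar>smooth_step z\<bar> \<le> M * 1"
          using M smooth_step_range[of z] by (intro mult_mono) auto
        then show ?thesis by (simp add: abs_mult)
      qed
      from this[of "p x" "q x"] this[of "q x" "p x"]
      have "\<bar>smooth_step' (p x) * smooth_step (q x) - smooth_step (p x) * smooth_step' (q x)\<bar> \<le> 2 * M"
        by (simp add: mult.commute)
      then show ?thesis using l by (simp add: D_def divide_right_mono)
    qed
    show "\<exists>\<eta>. smooth_on UNIV \<eta> \<and>
     (\<forall>x. 0 \<le> \<eta> x \<and> \<eta> x \<le> 1) \<and> (\<forall>x. x \<notin> annulus a b \<longrightarrow> \<eta> x = 0) \<and>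
     (\<forall>x\<in>annulus (a + l) (b - l). \<eta> x = 1) \<and>
     (\<forall>x. (d1 \<eta> x)\<^sup>2 + (d2 \<eta> x)\<^sup>2 \<le> (2 * M)\<^sup>2 / (l\<^sup>2 * (norm x)\<^sup>2)) \<and>
     (\<forall>x. x \<notin> annulus a (a + l) \<union> annulus (b - l) b \<longrightarrow> d1 \<eta> x = 0 \<and> d2 \<eta> x = 0)"
    proof (intro exI[of _ \<eta>] conjI allI impI ballI sm)
      fix x
      show "0 \<le> \<eta> x" "\<eta> x \<le> 1" using smooth_step_range by (auto simp: \<eta>_def mult_le_one)
      show "x \<notin> annulus a b \<Longrightarrow> \<eta> x = 0" by (rule out)
      show "\<eta> x = 1" if "x \<in> annulus (a + l) (b - l)"
      proof -
        have "x \<noteq> 0" using that by (auto simp: annulus_def)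
        then show ?thesis using that pq'[of x] by (auto simp: \<eta>_def annulus_def)
      qed
      show "(d1 \<eta> x)\<^sup>2 + (d2 \<eta> x)\<^sup>2 \<le> (2 * M)\<^sup>2 / (l\<^sup>2 * (norm x)\<^sup>2)"
      proof (cases "x = 0")
        case False
        have "(d1 \<eta> x)\<^sup>2 + (d2 \<eta> x)\<^sup>2 = (D x)\<^sup>2 * (((fst x)\<^sup>2 + (snd x)\<^sup>2) / ((norm x)\<^sup>2)\<^sup>2)"
          using der[OF False] by (simp add: power_mult_distrib power_divide add_divide_distrib distrib_left)
        also have "\<dots> = (D x)\<^sup>2 / (norm x)\<^sup>2"
          using False by (simp only: norm_sq[symmetric]) (simp add: power2_eq_square)
        also have "\<dots> \<le> (2 * M / l)\<^sup>2 / (norm x)\<^sup>2"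
          using power_mono[OF Db[of x], of 2] by (intro divide_right_mono) auto
        finally show ?thesis by (simp add: power_divide)
      qed (simp add: zero)
      assume x: "x \<notin> annulus a (a + l) \<union> annulus (b - l) b"
      have "D x = 0" if "x \<noteq> 0"
      proof -
        have "exp (a + l) \<le> exp (b - l)" using ab by simp
        then consider "norm x < exp a" | "norm x > exp b" | "norm x > exp (a + l)" "norm x < exp (b - l)"
          using x by (fastforce simp: annulus_def not_le)
        then show ?thesis using pq[OF that] by cases (auto simp: D_def)
      qed
      then show "d1 \<eta> x = 0" "d2 \<eta> x = 0" using der[of x] zero by (cases "x = 0"; simp)+
    qed
  qed
qed

subsection \<open>Annuli\<close>

lemma closed_annulus: "closed (annulus a b)"
  unfolding annulus_def by (intro closed_Collect_conj closed_Collect_le continuous_intros)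

lemma compact_annulus_Int: "closed S \<Longrightarrow> compact (annulus a b \<inter> S)"
proof -
  assume "closed S"
  moreover have "annulus a b = cball 0 (exp b) \<inter> annulus a b" by (auto simp: annulus_def)
  then have "compact (annulus a b)" using closed_annulus by (metis compact_Int_closed compact_cball)
  ultimately show ?thesis by (rule compact_Int_closed[rotated])
qed

lemma zero_notin_annulus [simp]: "0 \<notin> annulus a b"
  by (simp add: annulus_def)

lemma set_integrable_annulus:
  fixes f :: "real \<times> real \<Rightarrow> real"
  assumes "closed S" "continuous_on (S - {0}) f"
  shows "set_integrable lborel (annulus a b \<inter> S) f"
  unfolding set_integrable_def
  by (intro borel_integrable_compact compact_annulus_Int assms continuous_on_subset[OF assms(2)]) auto

text \<open>In logarithmic polar coordinates \<open>dx / |x|^2\<close> is the area of a cylinder,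
  hence the linear growth in the width \<open>n\<close>. The sharp constant is irrelevant: an
  annulus of width 1 lies in a square of side \<open>2 exp (a + 1)\<close> and the integrand is at
  most \<open>exp (- 2 a)\<close> there, which gives \<open>4 exp 2\<close>; adding up unit annuli
  gives the rest.\<close>

lemma annulus_inverse_square_bound:
  "\<exists>M>0. \<forall>a n S. closed S \<longrightarrow> (LINT x:annulus a (a + real n) \<inter> S|lborel. 1 / (norm x)\<^sup>2) \<le> M * real n"
proof -
  define M where "M = 4 * exp (2::real)"
  have int: "set_integrable lborel (annulus a b \<inter> S) (\<lambda>x. 1 / (norm x)\<^sup>2)" if "closed S" for a b S
    using that by (intro set_integrable_annulus continuous_intros) auto
  have int0: "set_integrable lborel (annulus a b) (\<lambda>x. 1 / (norm x)\<^sup>2)" for a b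
    using int[of UNIV] by simp
  have one: "(LINT x:annulus a (a + 1)|lborel. 1 / (norm x)\<^sup>2) \<le> M" for a
  proof -
    let ?e = "exp (a + 1)"
    let ?B = "cbox (- ?e, - ?e) (?e, ?e)"
    have sub: "annulus a (a + 1) \<subseteq> ?B"
    proof
      fix x assume "x \<in> annulus a (a + 1)"
      then have "norm x \<le> ?e" by (simp add: annulus_def)
      moreover have "\<bar>fst x\<bar> \<le> norm x" "\<bar>snd x\<bar> \<le> norm x"
        using norm_fst_le[of "fst x" "snd x"] norm_snd_le[of "snd x" "fst x"] by auto
      ultimately show "x \<in> ?B" by (cases x) (auto simp: cbox_Pair_eq)
    qed
    have "(LINT x:annulus a (a + 1)|lborel. 1 / (norm x)\<^sup>2) \<le> (LINT x:?B|lborel. exp (- 2 * a))"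
      unfolding set_lebesgue_integral_def
    proof (rule integral_mono)
      show "integrable lborel (\<lambda>x. indicat_real (annulus a (a + 1)) x *\<^sub>R (1 / (norm x)\<^sup>2))"
        using int0 by (simp add: set_integrable_def)
      show "integrable lborel (\<lambda>x::real\<times>real. indicat_real ?B x *\<^sub>R exp (- 2 * a))"
        by (intro borel_integrable_compact compact_cbox continuous_intros)
      fix x :: "real \<times> real"
      have "1 / (norm x)\<^sup>2 \<le> exp (- 2 * a)" if "x \<in> annulus a (a + 1)"
      proof -
        have "exp a ^ 2 \<le> (norm x)\<^sup>2" using that by (intro power_mono) (auto simp: annulus_def)
        moreover have "exp a ^ 2 = exp (2 * a)" by (simp add: exp_double)
        ultimately have "1 / (norm x)\<^sup>2 \<le> 1 / exp (2 * a)" by (intro divide_left_mono) (auto intro: mult_pos_pos order.strict_trans2[OF exp_gt_zero])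
        then show ?thesis by (simp add: exp_minus divide_inverse)
      qed
      then show "indicat_real (annulus a (a + 1)) x *\<^sub>R (1 / (norm x)\<^sup>2) \<le> indicat_real ?B x *\<^sub>R exp (- 2 * a)"
        using sub by (auto simp: indicator_def)
    qed
    also have "\<dots> = measure lborel ?B * exp (- 2 * a)" by (simp add: set_lebesgue_integral_def)
    also have "measure lborel ?B = (2 * ?e) * (2 * ?e)"
      by (simp add: content_Pair)
    also have "(2 * ?e) * (2 * ?e) * exp (- 2 * a) = M"
      by (simp add: M_def exp_add[symmetric] mult.assoc[symmetric] mult_exp_exp)
    finally show ?thesis .
  qed
  have many: "(LINT x:annulus a (a + real n)|lborel. 1 / (norm x)\<^sup>2) \<le> M * real n" for a n
  proof (induction n)
    case 0
    \<comment> \<open>Width 0 leaves a circle, which is a null set.\<close>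
    have "(LINT x:annulus a (a + real 0)|lborel. 1 / (norm x)\<^sup>2) \<le> (LINT x:annulus a a|lborel. 1 / (norm x)\<^sup>2)" by simp
    also have "\<dots> = 0"
    proof -
      have "annulus a a \<subseteq> sphere 0 (exp a)" by (auto simp: annulus_def)
      moreover have "negligible (sphere (0::real\<times>real) (exp a))" by (rule negligible_sphere)
      ultimately have "negligible (annulus a a)" by (rule negligible_subset[rotated])
      then have "emeasure lebesgue (annulus a a) = 0" by (simp add: negligible_iff_emeasure0[OF lmeasurable_compact[THEN fmeasurableD]] negligible_iff_null_sets null_setsD1)
      then have "annulus a a \<in> null_sets lborel" using closed_annulus
        by (simp add: null_sets_def borel_closed)
      then have "AE x in lborel. indicat_real (annulus a a) x *\<^sub>R (1 / (norm x)\<^sup>2) = 0"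
        by (rule AE_I') (auto simp: indicator_def)
      then show ?thesis unfolding set_lebesgue_integral_def by (rule integral_eq_zero_AE)
    qed
    finally show ?case by simp
  next
    case (Suc n)
    have "(LINT x:annulus a (a + real (Suc n))|lborel. 1 / (norm x)\<^sup>2)
      \<le> (LINT x|lborel. indicat_real (annulus a (a + real n)) x *\<^sub>R (1 / (norm x)\<^sup>2) +
           indicat_real (annulus (a + real n) (a + real n + 1)) x *\<^sub>R (1 / (norm x)\<^sup>2))"
      unfolding set_lebesgue_integral_def
    proof (rule integral_mono)
      show "integrable lborel (\<lambda>x. indicat_real (annulus a (a + real (Suc n))) x *\<^sub>R (1 / (norm x)\<^sup>2))"
        using int0 by (simp add: set_integrable_def)
      show "integrable lborel (\<lambda>x. indicat_real (annulus a (a + real n)) x *\<^sub>R (1 / (norm x)\<^sup>2) +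
           indicat_real (annulus (a + real n) (a + real n + 1)) x *\<^sub>R (1 / (norm x)\<^sup>2))"
        using int0 by (intro Bochner_Integration.integrable_add) (simp_all add: set_integrable_def)
      fix x :: "real \<times> real"
      show "indicat_real (annulus a (a + real (Suc n))) x *\<^sub>R (1 / (norm x)\<^sup>2) \<le>
         indicat_real (annulus a (a + real n)) x *\<^sub>R (1 / (norm x)\<^sup>2) +
           indicat_real (annulus (a + real n) (a + real n + 1)) x *\<^sub>R (1 / (norm x)\<^sup>2)"
        by (auto simp: indicator_def annulus_def algebra_simps)
    qed
    also have "\<dots> = (LINT x:annulus a (a + real n)|lborel. 1 / (norm x)\<^sup>2) 
        + (LINT x:annulus (a + real n) (a + real n + 1)|lborel. 1 / (norm x)\<^sup>2)"
      unfolding set_lebesgue_integral_def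
      by (rule Bochner_Integration.integral_add) (use int0 in \<open>simp_all add: set_integrable_def\<close>)
    also have "\<dots> \<le> M * real n + M" using Suc one[of "a + real n"] by linarith
    finally show ?case by (simp add: algebra_simps)
  qed
  show ?thesis
  proof (intro exI[of _ M] conjI allI impI)
    fix a n and S :: "(real \<times> real) set" assume S: "closed S"
    have "(LINT x:annulus a (a + real n) \<inter> S|lborel. 1 / (norm x)\<^sup>2) \<le> (LINT x:annulus a (a + real n)|lborel. 1 / (norm x)\<^sup>2)"
      unfolding set_lebesgue_integral_def
      using int[OF S] int0 by (intro integral_mono) (auto simp: set_integrable_def indicator_def)
    then show "(LINT x:annulus a (a + real n) \<inter> S|lborel. 1 / (norm x)\<^sup>2) \<le> M * real n"
      using many[of a n] by linarith
  qed (simp add: M_def)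
qed

subsection \<open>The quadratic form and its index\<close>

text \<open>One form for both problems: the plane is the case \<open>S = UNIV\<close>,
  \<open>B = 0\<close>.\<close>

definition quad_form :: "(real \<times> real) set \<Rightarrow> (real \<times> real \<Rightarrow> real) \<Rightarrow> (real \<Rightarrow> real) \<Rightarrow> (real \<times> real \<Rightarrow> real) \<Rightarrow> real" where
  "quad_form S V B \<phi> = (LINT x:S|lborel. (d1 \<phi> x)\<^sup>2 + (d2 \<phi> x)\<^sup>2 - V x * (\<phi> x)\<^sup>2)
     - (LINT s|lborel. B s * (\<phi> (s, 0))\<^sup>2)"

lemma partials_zero_outside:
  assumes "closed K" "\<And>x. x \<notin> K \<Longrightarrow> \<phi> x = 0" "x \<notin> K"
  shows "d1 \<phi> x = 0" "d2 \<phi> x = 0"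
proof -
  have "((\<lambda>_. 0) has_derivative (\<lambda>h. fst h * 0 + snd h * 0)) (at x)" by simp
  then have "(\<phi> has_derivative (\<lambda>h. fst h * 0 + snd h * 0)) (at x)"
    by (rule has_derivative_transform_within_open[where s = "- K"]) (use assms in auto)
  from d1_d2_eq[OF this] show "d1 \<phi> x = 0" "d2 \<phi> x = 0" .
qed

lemma test_fun_annulusI:
  assumes "smooth_on UNIV \<phi>" "\<And>x. x \<notin> annulus a b \<Longrightarrow> \<phi> x = 0"
  shows "\<phi> \<in> test_fun"
proof -
  have "closure {x. \<phi> x \<noteq> 0} \<subseteq> annulus a b"
    using assms(2) by (intro closure_minimal closed_annulus) auto
  moreover have "compact (annulus a b)" using compact_annulus_Int[of UNIV] by simp
  ultimately have "compact (closure {x. \<phi> x \<noteq> 0})"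
    by (metis closed_closure compact_Int_closed inf.absorb_iff2)
  with assms(1) show ?thesis by (simp add: test_fun_def)
qed

text \<open>\<open>V\<close> and \<open>B\<close> may blow up at the origin, but a support in an
  annulus stays away from it, so both integrands are continuous on a compact set and vanish
  outside.\<close>

lemma quad_form_integrable:
  assumes "closed S" "continuous_on (S - {0}) V" "continuous_on (- {0}) B"
    and \<phi>: "smooth_on UNIV \<phi>" "\<And>x. x \<notin> annulus a b \<Longrightarrow> \<phi> x = 0"
  shows "set_integrable lborel S (\<lambda>x. (d1 \<phi> x)\<^sup>2 + (d2 \<phi> x)\<^sup>2 - V x * (\<phi> x)\<^sup>2)"
    and "integrable lborel (\<lambda>s. B s * (\<phi> (s, 0))\<^sup>2)"
proof -
  note c = smooth_C1(2-4)[OF \<phi>(1)]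
  have "set_integrable lborel (annulus a b \<inter> S) (\<lambda>x. (d1 \<phi> x)\<^sup>2 + (d2 \<phi> x)\<^sup>2 - V x * (\<phi> x)\<^sup>2)"
    by (rule set_integrable_annulus) (use assms in \<open>auto intro!: continuous_intros continuous_on_subset[OF c(1)] continuous_on_subset[OF c(2)] continuous_on_subset[OF c(3)]\<close>)
  moreover have "indicat_real (annulus a b \<inter> S) x *\<^sub>R ((d1 \<phi> x)\<^sup>2 + (d2 \<phi> x)\<^sup>2 - V x * (\<phi> x)\<^sup>2) =
     indicat_real S x *\<^sub>R ((d1 \<phi> x)\<^sup>2 + (d2 \<phi> x)\<^sup>2 - V x * (\<phi> x)\<^sup>2)" for x
    using \<phi>(2)[of x] partials_zero_outside[OF closed_annulus \<phi>(2), where x = x] by (auto simp: indicator_def)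
  ultimately show "set_integrable lborel S (\<lambda>x. (d1 \<phi> x)\<^sup>2 + (d2 \<phi> x)\<^sup>2 - V x * (\<phi> x)\<^sup>2)"
    by (simp only: set_integrable_def)
  \<comment> \<open>The trace of the annulus on the boundary line.\<close>
  define K where "K = {s. exp a \<le> \<bar>s::real\<bar>} \<inter> {- exp b..exp b}"
  have "compact K" unfolding K_def
    by (intro closed_Int_compact closed_Collect_le continuous_intros) auto
  moreover have "continuous_on K (\<lambda>s. B s * (\<phi> (s, 0))\<^sup>2)"
    by (intro continuous_intros continuous_on_subset[OF assms(3)] continuous_on_compose2[OF c(1)]) (auto simp: K_def)
  ultimately have "integrable lborel (\<lambda>s. indicat_real K s *\<^sub>R (B s * (\<phi> (s, 0))\<^sup>2))"
    by (rule borel_integrable_compact)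
  moreover have "indicat_real K s *\<^sub>R (B s * (\<phi> (s, 0))\<^sup>2) = B s * (\<phi> (s, 0))\<^sup>2" for s
  proof -
    have "(s, 0) \<in> annulus a b \<longleftrightarrow> s \<in> K"
      by (auto simp: K_def annulus_def norm_prod_def abs_le_iff)
    then show ?thesis using \<phi>(2)[of "(s, 0)"] by (auto simp: indicator_def)
  qed
  ultimately show "integrable lborel (\<lambda>s. B s * (\<phi> (s, 0))\<^sup>2)" by (simp only:)
qed

lemma sum_square_orthogonal:
  fixes z :: "'i \<Rightarrow> real"
  assumes "finite I" "\<And>i j. i \<in> I \<Longrightarrow> j \<in> I \<Longrightarrow> i \<noteq> j \<Longrightarrow> z i * z j = 0"
  shows "(\<Sum>i\<in>I. z i)\<^sup>2 = (\<Sum>i\<in>I. (z i)\<^sup>2)"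
proof -
  have "(\<Sum>i\<in>I. z i)\<^sup>2 = (\<Sum>i\<in>I. \<Sum>j\<in>I. z i * z j)"
    by (simp add: power2_eq_square sum_product)
  also have "\<dots> = (\<Sum>i\<in>I. \<Sum>j\<in>I. if j = i then (z i)\<^sup>2 else 0)"
    using assms(2) by (intro sum.cong refl) (auto simp: power2_eq_square)
  finally show ?thesis using assms(1) by simp
qed

text \<open>The form is diagonal on functions with disjoint annuli: at each point at most one of
  them is nonzero, and the same holds for their partials, since these vanish off the closed annulus.
  All cross products therefore vanish pointwise.\<close>

lemma quad_form_sum:
  fixes n :: nat
  assumes S: "closed S" "continuous_on (S - {0}) V" "continuous_on (- {0}) B"
    and \<phi>: "\<And>i. i < n \<Longrightarrow> smooth_on UNIV (\<phi> i)"
      "\<And>i x. i < n \<Longrightarrow> x \<notin> annulus (a i) (b i) \<Longrightarrow> \<phi> i x = 0"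
    and disj: "\<And>i j. i < j \<Longrightarrow> j < n \<Longrightarrow> b i < a j"
  shows "quad_form S V B (\<lambda>x. \<Sum>i<n. c i * \<phi> i x) = (\<Sum>i<n. (c i)\<^sup>2 * quad_form S V B (\<phi> i))"
proof -
  define F where "F \<phi> x = (d1 \<phi> x)\<^sup>2 + (d2 \<phi> x)\<^sup>2 - V x * (\<phi> x)\<^sup>2" for \<phi> x
  note der = smooth_C1(1)[OF \<phi>(1)]
  have "((\<lambda>x. \<Sum>i<n. c i * \<phi> i x) has_derivative
     (\<lambda>h. fst h * (\<Sum>i<n. c i * d1 (\<phi> i) x) + snd h * (\<Sum>i<n. c i * d2 (\<phi> i) x))) (at x)" for x
  proof -
    have "((\<lambda>x. \<Sum>i<n. c i * \<phi> i x) has_derivative (\<lambda>h. \<Sum>i<n. c i * (fst h * d1 (\<phi> i) x + snd h * d2 (\<phi> i) x))) (at x)"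
      by (intro has_derivative_sum has_derivative_mult_right der) auto
    then show ?thesis by (simp add: distrib_left sum.distrib sum_distrib_left mult_ac)
  qed
  from d1_d2_eq[OF this]
  have dsum: "d1 (\<lambda>x. \<Sum>i<n. c i * \<phi> i x) x = (\<Sum>i<n. c i * d1 (\<phi> i) x)" 
    "d2 (\<lambda>x. \<Sum>i<n. c i * \<phi> i x) x = (\<Sum>i<n. c i * d2 (\<phi> i) x)" for x by auto
  have one: "x \<notin> annulus (a i) (b i) \<or> x \<notin> annulus (a j) (b j)" if "i < n" "j < n" "i \<noteq> j" for i j x
  proof -
    have "b i < a j \<or> b j < a i" using disj[of i j] disj[of j i] that by (cases i j rule: linorder_cases) auto
    then have "exp (b i) < exp (a j) \<or> exp (b j) < exp (a i)" by simp
    then show ?thesis unfolding annulus_def mem_Collect_eq by linarith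
  qed
  have orth: "(\<Sum>i<n. c i * g i)\<^sup>2 = (\<Sum>i<n. (c i)\<^sup>2 * (g i)\<^sup>2)" 
    if "\<And>i. i < n \<Longrightarrow> x \<notin> annulus (a i) (b i) \<Longrightarrow> g i = 0" for g x
  proof -
    have "(c i * g i) * (c j * g j) = 0" if "i < n" "j < n" "i \<noteq> j" for i j
      using one[OF that, of x] \<open>\<And>i. i < n \<Longrightarrow> x \<notin> annulus (a i) (b i) \<Longrightarrow> g i = 0\<close> that by auto
    then show ?thesis by (subst sum_square_orthogonal) (auto simp: power_mult_distrib)
  qed
  have sq: "(\<Sum>i<n. c i * \<phi> i x)\<^sup>2 = (\<Sum>i<n. (c i)\<^sup>2 * (\<phi> i x)\<^sup>2)" for x
    using \<phi>(2) by (intro orth)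
  have sqd: "(\<Sum>i<n. c i * d1 (\<phi> i) x)\<^sup>2 = (\<Sum>i<n. (c i)\<^sup>2 * (d1 (\<phi> i) x)\<^sup>2)"
     "(\<Sum>i<n. c i * d2 (\<phi> i) x)\<^sup>2 = (\<Sum>i<n. (c i)\<^sup>2 * (d2 (\<phi> i) x)\<^sup>2)" for x
  proof -
    have z: "d1 (\<phi> i) x = 0 \<and> d2 (\<phi> i) x = 0" if "i < n" "x \<notin> annulus (a i) (b i)" for i
      using partials_zero_outside[of "annulus (a i) (b i)" "\<phi> i"] closed_annulus \<phi>(2) that by blast
    then show "(\<Sum>i<n. c i * d1 (\<phi> i) x)\<^sup>2 = (\<Sum>i<n. (c i)\<^sup>2 * (d1 (\<phi> i) x)\<^sup>2)"
      "(\<Sum>i<n. c i * d2 (\<phi> i) x)\<^sup>2 = (\<Sum>i<n. (c i)\<^sup>2 * (d2 (\<phi> i) x)\<^sup>2)"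
      by (auto intro: orth[of x])
  qed
  have F: "F (\<lambda>x. \<Sum>i<n. c i * \<phi> i x) x = (\<Sum>i<n. (c i)\<^sup>2 * F (\<phi> i) x)" for x
    unfolding F_def dsum sq sqd
    by (simp add: sum.distrib[symmetric] sum_subtractf[symmetric] sum_distrib_left algebra_simps)
  have "(LINT x:S|lborel. F (\<lambda>x. \<Sum>i<n. c i * \<phi> i x) x) = (\<Sum>i<n. (c i)\<^sup>2 * (LINT x:S|lborel. F (\<phi> i) x))"
  proof -
    have "(LINT x:S|lborel. F (\<lambda>x. \<Sum>i<n. c i * \<phi> i x) x) = 
      (LINT x|lborel. (\<Sum>i<n. (c i)\<^sup>2 * (indicat_real S x *\<^sub>R F (\<phi> i) x)))"
      unfolding F set_lebesgue_integral_def by (simp add: sum_distrib_left mult_ac)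
    also have "\<dots> = (\<Sum>i<n. (LINT x|lborel. (c i)\<^sup>2 * (indicat_real S x *\<^sub>R F (\<phi> i) x)))"
      using quad_form_integrable(1)[OF S \<phi>]
      by (intro Bochner_Integration.integral_sum integrable_mult_right) (auto simp: set_integrable_def F_def)
    finally show ?thesis by (simp add: set_lebesgue_integral_def)
  qed
  moreover have "(LINT s|lborel. B s * (\<Sum>i<n. c i * \<phi> i (s, 0))\<^sup>2) = (\<Sum>i<n. (c i)\<^sup>2 * (LINT s|lborel. B s * (\<phi> i (s, 0))\<^sup>2))"
  proof -
    have "(LINT s|lborel. B s * (\<Sum>i<n. c i * \<phi> i (s, 0))\<^sup>2) = (LINT s|lborel. (\<Sum>i<n. (c i)\<^sup>2 * (B s * (\<phi> i (s, 0))\<^sup>2)))"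
      unfolding sq by (simp add: sum_distrib_left mult_ac)
    also have "\<dots> = (\<Sum>i<n. (LINT s|lborel. (c i)\<^sup>2 * (B s * (\<phi> i (s, 0))\<^sup>2)))"
      using quad_form_integrable(2)[OF S \<phi>]
      by (intro Bochner_Integration.integral_sum integrable_mult_right) auto
    finally show ?thesis by simp
  qed
  moreover have "quad_form S V B \<psi> = (LINT x:S|lborel. F \<psi> x) - (LINT s|lborel. B s * (\<psi> (s, 0))\<^sup>2)" for \<psi>
    by (simp add: quad_form_def F_def)
  ultimately show ?thesis
    by (simp add: sum_subtractf right_diff_distrib)
qed

section \<open>Lower bounds for the index from disjointly supported test functions\<close>

lemma morse_index_ge:
  assumes S: "closed S" "continuous_on (S - {0}) V" "continuous_on (- {0}) B"
    and \<phi>: "\<And>i. i < n \<Longrightarrow> smooth_on UNIV (\<phi> i)"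
      "\<And>i x. i < n \<Longrightarrow> x \<notin> annulus (a i) (b i) \<Longrightarrow> \<phi> i x = 0"
      "\<And>i. i < n \<Longrightarrow> quad_form S V B (\<phi> i) < 0"
    and disj: "\<And>i j. i < j \<Longrightarrow> j < n \<Longrightarrow> b i < a j"
  shows "enat n \<le> morse_index (quad_form S V B)"
proof -
  have "quad_form S V B (\<lambda>x. \<Sum>i<n. c i * \<phi> i x) < 0" if "i < n" "c i \<noteq> 0" for c i
  proof -
    have "(\<Sum>i<n. (c i)\<^sup>2 * quad_form S V B (\<phi> i)) < (\<Sum>i<n. 0)"
    proof (rule sum_strict_mono_ex1)
      show "\<forall>i\<in>{..<n}. (c i)\<^sup>2 * quad_form S V B (\<phi> i) \<le> 0"
        using \<phi>(3) by (auto intro!: mult_nonneg_nonpos simp: less_imp_le)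
      show "\<exists>i\<in>{..<n}. (c i)\<^sup>2 * quad_form S V B (\<phi> i) < 0"
        using that \<phi>(3) by (intro bexI[of _ i]) (auto intro!: mult_pos_neg)
    qed simp
    moreover have "quad_form S V B (\<lambda>x. \<Sum>i<n. c i * \<phi> i x) = (\<Sum>i<n. (c i)\<^sup>2 * quad_form S V B (\<phi> i))"
      by (rule quad_form_sum[OF S \<phi>(1,2) disj])
    ultimately show ?thesis by simp
  qed
  moreover have "\<phi> i \<in> test_fun" if "i < n" for i
    using test_fun_annulusI[OF \<phi>(1)[OF that] \<phi>(2)[OF that]] .
  ultimately show ?thesis unfolding morse_index_def by (intro SUP_upper) blast
qed

lemma morse_index_infinite:
  assumes S: "closed S" "continuous_on (S - {0}) V" "continuous_on (- {0}) B"
    and neg: "\<And>T. \<exists>\<phi> b. smooth_on UNIV \<phi> \<and> (\<forall>x. x \<notin> annulus T b \<longrightarrow> \<phi> x = 0) \<and> quad_form S V B \<phi> < 0"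
  shows "morse_index (quad_form S V B) = \<infinity>"
proof -
  obtain \<phi> b where \<phi>: "\<And>T. smooth_on UNIV (\<phi> T)" "\<And>T x. x \<notin> annulus T (b T) \<Longrightarrow> \<phi> T x = 0"
    "\<And>T. quad_form S V B (\<phi> T) < 0" using neg by metis
  \<comment> \<open>Greedy choice: each test function is taken beyond the outer radius of the
    previous one. The \<open>+ 1\<close> makes the annuli strictly disjoint, and the maximum keeps
    \<open>t\<close> monotone even if some \<open>b T\<close> is below \<open>T\<close>.\<close>
  define t where "t = rec_nat 0 (\<lambda>_ T. max T (b T) + 1)"
  have tS: "t (Suc i) = max (t i) (b (t i)) + 1" for i by (simp add: t_def)
  have "mono t" by (rule incseq_SucI) (simp add: tS)
  have disj: "b (t i) < t j" if "i < j" for i j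
  proof -
    have "b (t i) < t (Suc i)" by (simp add: tS)
    also have "\<dots> \<le> t j" using \<open>mono t\<close> that by (simp add: monoD Suc_leI)
    finally show ?thesis .
  qed
  have "enat n \<le> morse_index (quad_form S V B)" for n
    by (rule morse_index_ge[OF S, where \<phi> = "\<lambda>i. \<phi> (t i)" and a = t and b = "\<lambda>i. b (t i)"])
       (use \<phi> disj in auto)
  then show ?thesis by (metis enat_ord_simps(6) enat_ord_code(5) not_enat_eq not_less_iff_gr_or_eq Suc_ile_eq order.strict_iff_not)
qed

text \<open>If no negative test function lives beyond radius \<open>exp T\<close>, then the mass of \<open>W\<close> on the
  annuli with \<open>N = 2\<^sup>j\<close> is at most \<open>C / 2\<^sup>j\<close>, so the total mass is finite.\<close>

lemma morse_index_dichotomy: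
  fixes S :: "(real \<times> real) set" and V W :: "real \<times> real \<Rightarrow> real" and B :: "real \<Rightarrow> real"
  assumes S: "closed S" "continuous_on (S - {0}) V" "continuous_on (- {0}) B"
    and W: "continuous_on (S - {0}) W" "\<And>x. x \<in> S - {0} \<Longrightarrow> W x > 0"
      "\<And>K. compact K \<Longrightarrow> set_integrable lborel (K \<inter> S) W"
    and ball: "r > 0" "cball z r \<subseteq> annulus 0 1 \<inter> S"
    and dich: "\<And>T N. N \<ge> 1 \<Longrightarrow> (\<exists>\<phi> b. smooth_on UNIV \<phi> \<and> (\<forall>x. x \<notin> annulus T b \<longrightarrow> \<phi> x = 0) \<and> quad_form S V B \<phi> < 0)
         \<or> (LINT x:annulus (T + real N + 1) (T + 2 * real N + 1) \<inter> S|lborel. W x) \<le> C / real N"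
  shows "morse_index (quad_form S V B) \<ge> 1"
    and "(\<integral>\<^sup>+x\<in>S. ennreal (W x) \<partial>lborel) = \<infinity> \<Longrightarrow> morse_index (quad_form S V B) = \<infinity>"
proof -
  note Wint = set_integrable_annulus[OF S(1) W(1)]
  have Wnn: "W x \<ge> 0" if "x \<in> S" "x \<noteq> 0" for x using W(2)[of x] that by simp
  \<comment> \<open>The fixed mass to be contradicted. It is positive because the continuous
    positive function \<open>W\<close> has a positive minimum on the given ball.\<close>
  define I0 where "I0 = (LINT x:annulus 0 1 \<inter> S|lborel. W x)"
  have I0: "I0 > 0"
  proof -
    have cW: "continuous_on (cball z r) W"
      by (rule continuous_on_subset[OF W(1)]) (use ball zero_notin_annulus in blast)
    obtain y where y: "y \<in> cball z r" "\<And>x. x \<in> cball z r \<Longrightarrow> W y \<le> W x"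
      using continuous_attains_inf[OF compact_cball _ cW] ball(1) by force
    have "y \<in> S - {0}" using y(1) ball(2) zero_notin_annulus by blast
    then have Wy: "W y > 0" by (rule W(2))
    have "W y * measure lborel (cball z r) = (LINT x:cball z r|lborel. W y)"
      by (simp add: set_lebesgue_integral_def)
    also have "\<dots> \<le> I0" unfolding I0_def set_lebesgue_integral_def
    proof (rule integral_mono)
      show "integrable lborel (\<lambda>x. indicat_real (cball z r) x *\<^sub>R W y)"
        by (intro borel_integrable_compact compact_cball continuous_intros)
      show "integrable lborel (\<lambda>x. indicat_real (annulus 0 1 \<inter> S) x *\<^sub>R W x)"
        using Wint by (simp add: set_integrable_def)
      fix x
      have "x \<in> annulus 0 1 \<inter> S \<Longrightarrow> W x \<ge> 0" using Wnn[of x] by (cases "x = 0") auto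
      then show "indicat_real (cball z r) x *\<^sub>R W y \<le> indicat_real (annulus 0 1 \<inter> S) x *\<^sub>R W x"
        using y(2)[of x] ball(2) by (auto simp: indicator_def)
    qed
    finally show ?thesis using Wy content_cball_pos[OF ball(1), of z]
      using mult_pos_pos[of "W y" "measure lborel (cball z r)"] by linarith
  qed
  show "morse_index (quad_form S V B) \<ge> 1"
  proof -
    \<comment> \<open>For \<open>T = - (N + 1)\<close> the middle third has logarithmic radii 0 and
      \<open>N\<close>, so it contains the fixed annulus, and \<open>C / N < I0\<close> excludes the
      second alternative.\<close>
    obtain N where N: "real N > max 1 (C / I0)" using reals_Archimedean2 by blast
    then have N1: "N \<ge> 1" by linarith
    have "I0 \<le> (LINT x:annulus 0 (real N) \<inter> S|lborel. W x)"
      unfolding I0_def set_lebesgue_integral_def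
    proof (rule integral_mono)
      show "integrable lborel (\<lambda>x. indicat_real (annulus 0 1 \<inter> S) x *\<^sub>R W x)"
        "integrable lborel (\<lambda>x. indicat_real (annulus 0 (real N) \<inter> S) x *\<^sub>R W x)"
        using Wint by (simp_all add: set_integrable_def)
      fix x
      have "exp 1 \<le> exp (real N)" using N1 by simp
      then have "x \<in> annulus 0 1 \<Longrightarrow> x \<in> annulus 0 (real N)" 
        unfolding annulus_def mem_Collect_eq by linarith
      moreover have "x \<in> annulus 0 (real N) \<inter> S \<Longrightarrow> W x \<ge> 0" using Wnn[of x] by (cases "x = 0") auto
      ultimately show "indicat_real (annulus 0 1 \<inter> S) x *\<^sub>R W x \<le> indicat_real (annulus 0 (real N) \<inter> S) x *\<^sub>R W x"
        by (auto simp: indicator_def)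
    qed
    moreover have "C / real N < I0" using N I0 by (simp add: field_simps)
    ultimately have "\<not> (LINT x:annulus 0 (real N) \<inter> S|lborel. W x) \<le> C / real N" by linarith
    with dich[OF N1, of "- (real N + 1)"] obtain \<phi> b where
      \<phi>: "smooth_on UNIV \<phi>" "\<forall>x. x \<notin> annulus (- (real N + 1)) b \<longrightarrow> \<phi> x = 0" "quad_form S V B \<phi> < 0"
      by auto
    have "enat 1 \<le> morse_index (quad_form S V B)"
      by (rule morse_index_ge[OF S, where \<phi> = "\<lambda>_. \<phi>" and a = "\<lambda>_. - (real N + 1)" and b = "\<lambda>_. b"]) (use \<phi> in auto)
    then show ?thesis by (simp add: one_enat_def)
  qed
  assume inf: "(\<integral>\<^sup>+x\<in>S. ennreal (W x) \<partial>lborel) = \<infinity>"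
  show "morse_index (quad_form S V B) = \<infinity>"
  proof (rule ccontr)
    assume *: "morse_index (quad_form S V B) \<noteq> \<infinity>"
    obtain T where "\<not> (\<exists>\<phi> b. smooth_on UNIV \<phi> \<and> (\<forall>x. x \<notin> annulus T b \<longrightarrow> \<phi> x = 0) \<and> quad_form S V B \<phi> < 0)"
    proof (rule ccontr)
      assume "\<not> thesis"
      then have "morse_index (quad_form S V B) = \<infinity>"
        using that by (intro morse_index_infinite[OF S]) blast
      with * show False by simp
    qed
    with dich have small: "(LINT x:annulus (T + real N + 1) (T + 2 * real N + 1) \<inter> S|lborel. W x) \<le> C / real N"
      if "N \<ge> 1" for N using that by blast
    \<comment> \<open>\<open>W\<close> with the value at the origin replaced by 0, which makes it
      measurable and nonnegative everywhere; only a null set is affected.\<close>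
    define g where "g x = indicat_real (S - {0}) x *\<^sub>R W x" for x
    have gm: "g \<in> borel_measurable borel" unfolding g_def
      by (intro borel_measurable_continuous_on_indicator W(1)) (use S(1) in auto)
    have gnn: "g x \<ge> 0" for x using W(2)[of x] by (auto simp: g_def indicator_def)
    define \<mu> where "\<mu> = density lborel (\<lambda>x. ennreal (g x))"
    have \<mu>_eq: "emeasure \<mu> A = (\<integral>\<^sup>+x. ennreal (g x) * indicator A x \<partial>lborel)" if "A \<in> sets borel" for A
      unfolding \<mu>_def by (rule emeasure_density) (use that gm in auto)
    have ne: "AE x in lborel. x \<noteq> (0::real\<times>real)"
      by (rule AE_lborel_singleton)
    have \<mu>_K: "emeasure \<mu> K = ennreal (LINT x:K \<inter> S|lborel. W x)" if "compact K" for K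
    proof -
      have "emeasure \<mu> K = (\<integral>\<^sup>+x. ennreal (indicat_real (K \<inter> S) x *\<^sub>R W x) \<partial>lborel)"
        unfolding \<mu>_eq[OF borel_compact[OF that]]
        by (rule nn_integral_cong_AE, rule AE_mp[OF ne]) (auto simp: indicator_def g_def)
      also have "\<dots> = ennreal (LINT x:K \<inter> S|lborel. W x)" unfolding set_lebesgue_integral_def
      proof (rule nn_integral_eq_integral)
        show "integrable lborel (\<lambda>x. indicat_real (K \<inter> S) x *\<^sub>R W x)"
          using W(3)[OF that] by (simp add: set_integrable_def)
        show "AE x in lborel. 0 \<le> indicat_real (K \<inter> S) x *\<^sub>R W x"
          using ne by (rule AE_mp) (use Wnn in \<open>auto simp: indicator_def\<close>)
      qed
      finally show ?thesis .
    qed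
    \<comment> \<open>The middle thirds for \<open>N = 2 ^ j\<close>. The outer logarithmic radius
      of \<open>A j\<close> is the inner one of \<open>A (Suc j)\<close>, so these annuli cover
      everything outside the ball of radius \<open>exp (T + 2)\<close>.\<close>
    define A where "A j = annulus (T + 2 ^ j + 1) (T + 2 * 2 ^ j + 1)" for j :: nat
    have cA: "compact (annulus a b)" for a b using compact_annulus_Int[of UNIV] by simp
    have Asm: "emeasure \<mu> (A j) \<le> ennreal (C * (1 / 2) ^ j)" for j
    proof -
      have "(LINT x:A j \<inter> S|lborel. W x) \<le> C / 2 ^ j"
        using small[of "2 ^ j"] by (simp add: A_def)
      then show ?thesis unfolding \<mu>_K[OF cA, folded A_def] A_def[symmetric]
        using \<mu>_K[of "A j"] cA by (simp add: A_def power_divide ennreal_leI)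
    qed
    have cover: "UNIV \<subseteq> cball 0 (exp (T + 2)) \<union> (\<Union>j. A j)"
    proof
      fix x :: "real \<times> real"
      show "x \<in> cball 0 (exp (T + 2)) \<union> (\<Union>j. A j)"
      proof (cases "norm x \<le> exp (T + 2)")
        case False
        then have x: "norm x > 0" by (meson exp_gt_zero less_trans not_le)
        define y where "y = ln (norm x) - T - 1"
        have "ln (exp (T + 2)) < ln (norm x)" using False x by (subst ln_less_cancel_iff) auto
        then have "y > 1" by (simp add: y_def)
        obtain k0 where "y < 2 ^ k0" using real_arch_pow[of 2 y] by auto
        \<comment> \<open>The least \<open>k\<close> with \<open>y < 2 ^ k\<close>. Since
          \<open>y > 1\<close> it is positive, and its predecessor \<open>j\<close> satisfies
          \<open>2 ^ j \<le> y < 2 ^ Suc j\<close>.\<close>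
        define k where "k = (LEAST k. y < 2 ^ k)"
        have k: "y < 2 ^ k" unfolding k_def using \<open>y < 2 ^ k0\<close> by (rule LeastI)
        have "k \<noteq> 0" using k \<open>y > 1\<close> by (intro notI) simp
        then obtain j where j: "k = Suc j" by (cases k) auto
        have "\<not> y < 2 ^ j" using not_less_Least[of j "\<lambda>k. y < 2 ^ k"] j k_def by simp
        with k j have "T + 2 ^ j + 1 \<le> ln (norm x)" "ln (norm x) \<le> T + 2 * 2 ^ j + 1" by (auto simp: y_def)
        then have "exp (T + 2 ^ j + 1) \<le> norm x" "norm x \<le> exp (T + 2 * 2 ^ j + 1)" using x
          by (metis exp_le_cancel_iff exp_ln)+
        then show ?thesis by (auto simp: A_def annulus_def)
      qed simp
    qed
    have "\<infinity> = (\<integral>\<^sup>+x. ennreal (g x) * indicator UNIV x \<partial>lborel)"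
      unfolding inf[symmetric]
      by (rule nn_integral_cong_AE, rule AE_mp[OF ne]) (auto simp: indicator_def g_def)
    also have "\<dots> = emeasure \<mu> UNIV" by (subst \<mu>_eq) auto
    also have "\<dots> \<le> emeasure \<mu> (cball 0 (exp (T + 2)) \<union> (\<Union>j. A j))"
      by (rule emeasure_mono[OF cover]) (auto simp: \<mu>_def A_def closed_annulus borel_closed)
    also have "\<dots> \<le> emeasure \<mu> (cball 0 (exp (T + 2))) + emeasure \<mu> (\<Union>j. A j)"
      by (rule emeasure_subadditive) (auto simp: \<mu>_def A_def closed_annulus borel_closed)
    finally have top: "\<infinity> \<le> emeasure \<mu> (cball 0 (exp (T + 2))) + emeasure \<mu> (\<Union>j. A j)" .
    have "emeasure \<mu> (\<Union>j. A j) \<le> (\<Sum>j. emeasure \<mu> (A j))"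
      by (rule emeasure_subadditive_countably) (auto simp: \<mu>_def A_def closed_annulus borel_closed)
    \<comment> \<open>The absolute value makes the terms nonnegative, so that the series can be
      summed inside \<open>ennreal\<close>.\<close>
    also have "\<dots> \<le> (\<Sum>j. ennreal (\<bar>C\<bar> * (1 / 2) ^ j))"
      by (intro suminf_le summableI order.trans[OF Asm] ennreal_leI mult_right_mono) auto
    also have "\<dots> = ennreal (\<Sum>j. \<bar>C\<bar> * (1 / 2) ^ j)"
      by (intro suminf_ennreal2 summable_mult summable_geometric) auto
    also have "\<dots> < \<infinity>" by simp
    finally have "emeasure \<mu> (\<Union>j. A j) < \<infinity>" .
    moreover have "emeasure \<mu> (cball 0 (exp (T + 2))) < \<infinity>" by (subst \<mu>_K) auto
    ultimately show False using top by (auto simp: top_unique)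
  qed
qed

subsection \<open>The plane\<close>

text \<open>All three thirds have logarithmic width \<open>N\<close>. The gradient lives on the two
  outer ones, where the integral of \<open>1 / |x|^2\<close> is at most \<open>M N\<close>, and its
  square is at most \<open>C0 / (N^2 |x|^2)\<close>. This gives \<open>N^-2 N\<close> for the energy
  and \<open>N^-4 N\<close> for the quartic integral. The offset 1 from \<open>T\<close> is room for
  the vertical shift of the support in the half-plane.\<close>

lemma ex_cutoff_energy:
  "\<exists>C>0. \<forall>T N. N \<ge> 1 \<longrightarrow> (\<exists>\<eta>. smooth_on UNIV \<eta> \<and> (\<forall>x. 0 \<le> \<eta> x \<and> \<eta> x \<le> 1) \<and>
     (\<forall>x. x \<notin> annulus (T + 1) (T + 3 * real N + 1) \<longrightarrow> \<eta> x = 0) \<and>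
     (\<forall>x\<in>annulus (T + real N + 1) (T + 2 * real N + 1). \<eta> x = 1) \<and>
     (\<forall>S. closed S \<longrightarrow>
        (LINT x:S|lborel. (d1 \<eta> x)\<^sup>2 + (d2 \<eta> x)\<^sup>2) \<le> C / real N \<and>
        (LINT x:S|lborel. (norm x)\<^sup>2 * ((d1 \<eta> x)\<^sup>2 + (d2 \<eta> x)\<^sup>2)\<^sup>2) \<le> C / real N ^ 3))"
proof -
  obtain C0 where C0: "C0 > 0" and cut: "\<And>a b l. l > 0 \<Longrightarrow> a + 2 * l \<le> b \<Longrightarrow> (\<exists>\<eta>. smooth_on UNIV \<eta> \<and>
     (\<forall>x. 0 \<le> \<eta> x \<and> \<eta> x \<le> 1) \<and> (\<forall>x. x \<notin> annulus a b \<longrightarrow> \<eta> x = 0) \<and>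
     (\<forall>x\<in>annulus (a + l) (b - l). \<eta> x = 1) \<and>
     (\<forall>x. (d1 \<eta> x)\<^sup>2 + (d2 \<eta> x)\<^sup>2 \<le> C0 / (l\<^sup>2 * (norm x)\<^sup>2)) \<and>
     (\<forall>x. x \<notin> annulus a (a + l) \<union> annulus (b - l) b \<longrightarrow> d1 \<eta> x = 0 \<and> d2 \<eta> x = 0))"
    using ex_log_cutoff by blast
  obtain M where M: "M > 0" and ann: "\<And>a n S. closed S \<Longrightarrow> (LINT x:annulus a (a + real n) \<inter> S|lborel. 1 / (norm x)\<^sup>2) \<le> M * real n"
    using annulus_inverse_square_bound by blast
  \<comment> \<open>The sum of the constants of the two estimates, so that one \<open>C\<close>
    serves both.\<close>
  define C where "C = 2 * M * C0 + 2 * M * C0\<^sup>2"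
  show ?thesis
  proof (intro exI[of _ C] conjI allI impI)
    show "C > 0" using C0 M by (simp add: C_def add_pos_pos)
    fix T N assume N: "(1::nat) \<le> N"
    obtain \<eta> where \<eta>: "smooth_on UNIV \<eta>" "\<And>x. 0 \<le> \<eta> x \<and> \<eta> x \<le> 1"
      "\<And>x. x \<notin> annulus (T + 1) (T + 3 * real N + 1) \<Longrightarrow> \<eta> x = 0" 
      "\<And>x. x \<in> annulus (T + real N + 1) (T + 2 * real N + 1) \<Longrightarrow> \<eta> x = 1"
      "\<And>x. (d1 \<eta> x)\<^sup>2 + (d2 \<eta> x)\<^sup>2 \<le> C0 / ((real N)\<^sup>2 * (norm x)\<^sup>2)"
      "\<And>x. x \<notin> annulus (T + 1) (T + 1 + real N) \<union> annulus (T + 2 * real N + 1) (T + 2 * real N + 1 + real N) \<Longrightarrow> d1 \<eta> x = 0 \<and> d2 \<eta> x = 0"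
    proof -
      have e: "T + 3 * real N + 1 - real N = T + 2 * real N + 1" "T + 2 * real N + 1 + real N = T + 3 * real N + 1"
        "T + real N + 1 = T + 1 + real N" by auto
      show ?thesis using cut[of "real N" "T + 1" "T + 3 * real N + 1"] N that unfolding e by auto
    qed
    define G where "G x = (d1 \<eta> x)\<^sup>2 + (d2 \<eta> x)\<^sup>2" for x
    define E where "E = annulus (T + 1) (T + 1 + real N)" 
    define E' where "E' = annulus (T + 2 * real N + 1) (T + 2 * real N + 1 + real N)"
    have bound: "(LINT x:S|lborel. f x) \<le> c * (2 * M * real N)" 
      if S: "closed S" and c: "c \<ge> 0" and f: "\<And>x. f x \<le> c * (1 / (norm x)\<^sup>2)" "\<And>x. x \<notin> E \<union> E' \<Longrightarrow> f x = 0"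
      for f :: "real \<times> real \<Rightarrow> real" and c S
    proof -
      have int: "set_integrable lborel (annulus a b \<inter> S) (\<lambda>x. 1 / (norm x)\<^sup>2)" for a b
        using S by (intro set_integrable_annulus continuous_intros) auto
      have "(LINT x:S|lborel. f x) \<le> (LINT x|lborel. c * (indicat_real (E \<inter> S) x *\<^sub>R (1 / (norm x)\<^sup>2) + indicat_real (E' \<inter> S) x *\<^sub>R (1 / (norm x)\<^sup>2)))"
        unfolding set_lebesgue_integral_def
      proof (rule integral_mono')
        show "integrable lborel (\<lambda>x. c * (indicat_real (E \<inter> S) x *\<^sub>R (1 / (norm x)\<^sup>2) + indicat_real (E' \<inter> S) x *\<^sub>R (1 / (norm x)\<^sup>2)))"
          using int unfolding E_def E'_def set_integrable_def 
          by (intro integrable_mult_right Bochner_Integration.integrable_add)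
        fix x
        show "0 \<le> c * (indicat_real (E \<inter> S) x *\<^sub>R (1 / (norm x)\<^sup>2) + indicat_real (E' \<inter> S) x *\<^sub>R (1 / (norm x)\<^sup>2))"
          using c by (simp add: indicator_def)
        obtain r where r: "r = c * (1 / (norm x)\<^sup>2)" by simp
        have "0 \<le> r" "f x \<le> r" using c f(1)[of x] by (simp_all add: r)
        moreover have "c * (indicat_real (E \<inter> S) x *\<^sub>R (1 / (norm x)\<^sup>2) + indicat_real (E' \<inter> S) x *\<^sub>R (1 / (norm x)\<^sup>2))
          = indicat_real (E \<inter> S) x * r + indicat_real (E' \<inter> S) x * r"
          by (simp add: r algebra_simps)
        ultimately show "indicat_real S x *\<^sub>R f x \<le> c * (indicat_real (E \<inter> S) x *\<^sub>R (1 / (norm x)\<^sup>2) + indicat_real (E' \<inter> S) x *\<^sub>R (1 / (norm x)\<^sup>2))"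
          using f(2)[of x] by (auto simp: indicator_def)
      qed
      also have "\<dots> = c * ((LINT x:E \<inter> S|lborel. 1 / (norm x)\<^sup>2) + (LINT x:E' \<inter> S|lborel. 1 / (norm x)\<^sup>2))"
        using int unfolding E_def E'_def set_integrable_def set_lebesgue_integral_def by simp
      also have "\<dots> \<le> c * (M * real N + M * real N)"
        unfolding E_def E'_def by (intro mult_left_mono add_mono ann S c)
      finally show ?thesis by (simp add: algebra_simps)
    qed
    show "\<exists>\<eta>. smooth_on UNIV \<eta> \<and> (\<forall>x. 0 \<le> \<eta> x \<and> \<eta> x \<le> 1) \<and>
     (\<forall>x. x \<notin> annulus (T + 1) (T + 3 * real N + 1) \<longrightarrow> \<eta> x = 0) \<and>
     (\<forall>x\<in>annulus (T + real N + 1) (T + 2 * real N + 1). \<eta> x = 1) \<and>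
     (\<forall>S. closed S \<longrightarrow>
        (LINT x:S|lborel. (d1 \<eta> x)\<^sup>2 + (d2 \<eta> x)\<^sup>2) \<le> C / real N \<and>
        (LINT x:S|lborel. (norm x)\<^sup>2 * ((d1 \<eta> x)\<^sup>2 + (d2 \<eta> x)\<^sup>2)\<^sup>2) \<le> C / real N ^ 3)"
    proof (intro exI[of _ \<eta>] conjI allI impI ballI \<eta>)
      show "0 \<le> \<eta> x" "\<eta> x \<le> 1" for x using \<eta>(2) by auto
      fix S :: "(real \<times> real) set" assume S: "closed S"
      have z: "G x = 0" if "x \<notin> E \<union> E'" for x using \<eta>(6)[of x] that by (auto simp: G_def E_def E'_def)
      have "(LINT x:S|lborel. G x) \<le> C0 / (real N)\<^sup>2 * (2 * M * real N)"
        using C0 z \<eta>(5) by (intro bound S) (auto simp: G_def)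
      also have "\<dots> = 2 * M * C0 / real N" using N by (simp add: power2_eq_square)
      also have "\<dots> \<le> C / real N" using M by (intro divide_right_mono) (auto simp: C_def)
      finally show "(LINT x:S|lborel. (d1 \<eta> x)\<^sup>2 + (d2 \<eta> x)\<^sup>2) \<le> C / real N" by (simp add: G_def)
      have G2: "(norm x)\<^sup>2 * (G x)\<^sup>2 \<le> C0\<^sup>2 / real N ^ 4 * (1 / (norm x)\<^sup>2)" for x
      proof (cases "x = 0")
        case False
        have "(norm x)\<^sup>2 * (G x)\<^sup>2 \<le> (norm x)\<^sup>2 * (C0 / ((real N)\<^sup>2 * (norm x)\<^sup>2))\<^sup>2"
          using \<eta>(5)[of x] by (intro mult_left_mono power_mono) (auto simp: G_def)
        also have "\<dots> = C0\<^sup>2 / real N ^ 4 * (1 / (norm x)\<^sup>2)"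
          using False N by (simp add: field_simps power2_eq_square power4_eq_xxxx)
        finally show ?thesis .
      qed (simp add: G_def)
      have "(LINT x:S|lborel. (norm x)\<^sup>2 * (G x)\<^sup>2) \<le> C0\<^sup>2 / real N ^ 4 * (2 * M * real N)"
        using C0 z G2 by (intro bound S) auto
      also have "\<dots> = 2 * M * C0\<^sup>2 / real N ^ 3" using N by (simp add: power4_eq_xxxx power3_eq_cube mult_ac)
      also have "\<dots> \<le> C / real N ^ 3" using M C0 by (intro divide_right_mono) (auto simp: C_def)
      finally show "(LINT x:S|lborel. (norm x)\<^sup>2 * ((d1 \<eta> x)\<^sup>2 + (d2 \<eta> x)\<^sup>2)\<^sup>2) \<le> C / real N ^ 3"
        by (simp add: G_def)
    qed
  qed
qed

lemma annulus_mono: "a \<le> a' \<Longrightarrow> b' \<le> b \<Longrightarrow> annulus a' b' \<subseteq> annulus a b"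
  unfolding annulus_def by (auto intro: order_trans[of "exp a" "exp a'"] order_trans[of _ "exp b'" "exp b"])

text \<open>Supplies the ball that certifies positive mass, for both domains. Norms on it lie
  between \<open>3/2\<close> and \<open>5/2\<close>, and \<open>5/2 = 1 + 1 + 1/2\<close> is a
  Taylor lower bound for \<open>exp 1\<close>.\<close>

lemma cball_in_annulus: "cball (0, 2) (1/2) \<subseteq> annulus 0 1 \<inter> upper_half"
proof
  fix x :: "real \<times> real" assume "x \<in> cball (0, 2) (1/2)"
  then have d: "norm (x - (0, 2)) \<le> 1 / 2" by (simp add: dist_norm norm_minus_commute)
  have n2: "norm ((0, 2) :: real \<times> real) = 2" by (simp add: norm_Pair)
  have "norm x \<le> norm ((0, 2) :: real \<times> real) + norm (x - (0, 2))" by (rule norm_triangle_sub)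
  moreover have "norm ((0, 2) :: real \<times> real) \<le> norm x + norm (x - (0, 2))"
    using norm_triangle_sub[of "(0, 2)" x] by (simp add: norm_minus_commute)
  moreover have "1 + 1 + 1 / 2 \<le> exp (1::real)"
    using exp_lower_Taylor_quadratic[of 1] by simp
  moreover have "\<bar>snd (x - (0, 2))\<bar> \<le> norm (x - (0, 2))"
    using norm_snd_le[of "snd (x - (0, 2))" "fst (x - (0, 2))"] by (simp only: prod.collapse real_norm_def)
  ultimately show "x \<in> annulus 0 1 \<inter> upper_half" using d n2
    by (simp add: annulus_def upper_half_def)
qed

lemma morse_index_plane_solution:
  assumes K0: "K0 > 0" and sol: "sol_plane K0 \<alpha> v"
  shows "morse_index (Q_plane K0 \<alpha> v) \<ge> 1"
    and "(\<integral>\<^sup>+x. ennreal (norm x powr (2*\<alpha>) * exp (v x)) \<partial>lborel) = \<infinity> \<Longrightarrow> morse_index (Q_plane K0 \<alpha> v) = \<infinity>"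
proof -
  define W where "W x = norm x powr (2*\<alpha>) * exp (v x)" for x :: "real \<times> real"
  define V where "V x = 2 * K0 * W x" for x :: "real \<times> real"
  have Q: "Q_plane K0 \<alpha> v = quad_form UNIV V (\<lambda>_. 0)"
    by (rule ext) (simp add: Q_plane_def quad_form_def set_lebesgue_integral_def V_def W_def mult.assoc)
  have cv: "continuous_on (UNIV - {0}) v"
    using sol Ck_imp_continuous by (auto simp: sol_plane_def smooth_on_def)
  have cW: "continuous_on (UNIV - {0}) W" unfolding W_def
    by (intro continuous_intros cv) auto
  then have cV: "continuous_on (UNIV - {0}) V" unfolding V_def by (intro continuous_intros)
  have Wpos: "W x > 0" if "x \<in> UNIV - {0}" for x using that by (simp add: W_def)
  have Wnn: "W x \<ge> 0" for x by (simp add: W_def)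
  obtain C where C: "C > 0" and cut: "\<And>T N. N \<ge> 1 \<Longrightarrow> (\<exists>\<eta>. smooth_on UNIV \<eta> \<and> (\<forall>x. 0 \<le> \<eta> x \<and> \<eta> x \<le> 1) \<and>
     (\<forall>x. x \<notin> annulus (T + 1) (T + 3 * real N + 1) \<longrightarrow> \<eta> x = 0) \<and>
     (\<forall>x\<in>annulus (T + real N + 1) (T + 2 * real N + 1). \<eta> x = 1) \<and>
     (\<forall>S. closed S \<longrightarrow>
        (LINT x:S|lborel. (d1 \<eta> x)\<^sup>2 + (d2 \<eta> x)\<^sup>2) \<le> C / real N \<and>
        (LINT x:S|lborel. (norm x)\<^sup>2 * ((d1 \<eta> x)\<^sup>2 + (d2 \<eta> x)\<^sup>2)\<^sup>2) \<le> C / real N ^ 3))"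
    using ex_cutoff_energy by blast
  \<comment> \<open>The cutoff itself is tested: its energy is at most \<open>C / N\<close>, while
    the potential contributes at least \<open>2 K0\<close> times the mass of the annulus where
    \<open>\<eta> = 1\<close>. Equating the two yields the constant
    \<open>C / (2 K0)\<close>.\<close>
  have dich: "(\<exists>\<phi> b. smooth_on UNIV \<phi> \<and> (\<forall>x. x \<notin> annulus T b \<longrightarrow> \<phi> x = 0) \<and> quad_form UNIV V (\<lambda>_. 0) \<phi> < 0)
         \<or> (LINT x:annulus (T + real N + 1) (T + 2 * real N + 1) \<inter> UNIV|lborel. W x) \<le> (C / (2 * K0)) / real N"
    if N: "N \<ge> 1" for T N
  proof (rule disjCI)
    let ?A = "annulus (T + real N + 1) (T + 2 * real N + 1)"
    assume "\<not> (LINT x:?A \<inter> UNIV|lborel. W x) \<le> (C / (2 * K0)) / real N"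
    then have big: "C / real N < 2 * K0 * (LINT x:?A|lborel. W x)"
      using K0 N by (simp add: field_simps)
    obtain \<eta> where \<eta>: "smooth_on UNIV \<eta>" "\<And>x. 0 \<le> \<eta> x \<and> \<eta> x \<le> 1"
     "\<And>x. x \<notin> annulus (T + 1) (T + 3 * real N + 1) \<Longrightarrow> \<eta> x = 0"
     "\<And>x. x \<in> ?A \<Longrightarrow> \<eta> x = 1"
     "(LINT x:UNIV|lborel. (d1 \<eta> x)\<^sup>2 + (d2 \<eta> x)\<^sup>2) \<le> C / real N"
      using cut[OF N, of T] closed_UNIV by blast
    \<comment> \<open>The gradient part is the form with \<open>V = 0\<close>; the potential part is
      then a difference of integrable functions.\<close>
    have i1: "integrable lborel (\<lambda>x. (d1 \<eta> x)\<^sup>2 + (d2 \<eta> x)\<^sup>2)"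
      using quad_form_integrable(1)[of UNIV "\<lambda>_. 0" "\<lambda>_. 0", OF _ _ _ \<eta>(1,3)]
      by (simp add: set_integrable_def)
    have i2: "integrable lborel (\<lambda>x. (d1 \<eta> x)\<^sup>2 + (d2 \<eta> x)\<^sup>2 - V x * (\<eta> x)\<^sup>2)"
      using quad_form_integrable(1)[of UNIV V "\<lambda>_. 0", OF _ cV _ \<eta>(1,3)]
      by (simp add: set_integrable_def)
    have i3: "integrable lborel (\<lambda>x. V x * (\<eta> x)\<^sup>2)"
      using Bochner_Integration.integrable_diff[OF i1 i2] by simp
    have "2 * K0 * (LINT x:?A|lborel. W x) = (LINT x|lborel. indicat_real ?A x *\<^sub>R V x)"
      by (simp add: set_lebesgue_integral_def V_def mult.left_commute)
    also have "\<dots> \<le> (LINT x|lborel. V x * (\<eta> x)\<^sup>2)"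
    proof (rule integral_mono'[OF i3])
      fix x
      show "indicat_real ?A x *\<^sub>R V x \<le> V x * (\<eta> x)\<^sup>2" "0 \<le> V x * (\<eta> x)\<^sup>2"
        using Wnn[of x] K0 \<eta>(4)[of x] by (auto simp: indicator_def V_def)
    qed
    finally have "(LINT x|lborel. (d1 \<eta> x)\<^sup>2 + (d2 \<eta> x)\<^sup>2 - V x * (\<eta> x)\<^sup>2) < 0"
      using big \<eta>(5) by (simp add: Bochner_Integration.integral_diff[OF i1 i3] set_lebesgue_integral_def)
    then have "quad_form UNIV V (\<lambda>_. 0) \<eta> < 0"
      by (simp add: quad_form_def set_lebesgue_integral_def)
    moreover have "\<eta> x = 0" if "x \<notin> annulus T (T + 3 * real N + 1)" for x
      using \<eta>(3) annulus_mono[of T "T + 1"] that by (meson le_add_same_cancel1 order_refl subsetD zero_le_one)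
    ultimately show "\<exists>\<phi> b. smooth_on UNIV \<phi> \<and> (\<forall>x. x \<notin> annulus T b \<longrightarrow> \<phi> x = 0) \<and> quad_form UNIV V (\<lambda>_. 0) \<phi> < 0"
      using \<eta>(1) by blast
  qed
  have loc: "set_integrable lborel (K \<inter> UNIV) W" if "compact K" for K
    using sol that by (simp add: sol_plane_def W_def[abs_def])
  have ball: "(1/2::real) > 0" "cball (0, 2) (1/2) \<subseteq> annulus 0 1 \<inter> UNIV"
    using cball_in_annulus by auto
  show "morse_index (Q_plane K0 \<alpha> v) \<ge> 1" unfolding Q
    by (rule morse_index_dichotomy(1)[OF closed_UNIV cV _ cW Wpos loc ball dich]) auto
  assume "(\<integral>\<^sup>+x. ennreal (norm x powr (2*\<alpha>) * exp (v x)) \<partial>lborel) = \<infinity>"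
  then show "morse_index (Q_plane K0 \<alpha> v) = \<infinity>" unfolding Q
    by (intro morse_index_dichotomy(2)[OF closed_UNIV cV _ cW Wpos loc ball dich]) (auto simp: W_def)
qed

subsection \<open>Integration on the half-plane\<close>

text \<open>Bridge from the Lebesgue integrals of the form to the gauge integral, for which the
  fundamental theorem and the iterated integrals below are stated.\<close>

lemma LINT_eq_integral_compact:
  fixes f :: "'a::euclidean_space \<Rightarrow> real"
  assumes "compact K" "K \<subseteq> S" "continuous_on K f" "\<And>x. x \<in> S - K \<Longrightarrow> f x = 0"
  shows "set_integrable lborel S f" "(LINT x:S|lborel. f x) = integral K f"
proof -
  have i: "set_integrable lborel K f"
    unfolding set_integrable_def using assms(1,3) by (rule borel_integrable_compact)
  have "indicat_real S x *\<^sub>R f x = indicat_real K x *\<^sub>R f x" for x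
    using assms(2,4) by (auto simp: indicator_def)
  with i set_borel_integral_eq_integral(2)[OF i]
  show "set_integrable lborel S f" "(LINT x:S|lborel. f x) = integral K f"
    by (simp_all only: set_integrable_def set_lebesgue_integral_def)
qed

abbreviation half_box :: "real \<Rightarrow> (real \<times> real) set" where
  "half_box R \<equiv> cbox (- R, 0) (R, R)"

lemma half_box_subset: "half_box R \<subseteq> upper_half"
  by (auto simp: cbox_Pair_eq upper_half_def)

lemma outside_half_box:
  assumes "x \<in> upper_half - half_box R"
  shows "norm x > R"
proof -
  have "\<bar>fst x\<bar> \<le> norm x" "\<bar>snd x\<bar> \<le> norm x"
    using norm_fst_le[of "fst x" "snd x"] norm_snd_le[of "snd x" "fst x"] by auto
  moreover have "\<not> (\<bar>fst x\<bar> \<le> R \<and> \<bar>snd x\<bar> \<le> R)"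
    using assms by (cases x) (auto simp: cbox_Pair_eq upper_half_def)
  ultimately show ?thesis by linarith
qed

lemma LINT_upper_half:
  fixes f :: "real \<times> real \<Rightarrow> real"
  assumes "continuous_on upper_half f" "\<And>x. x \<in> upper_half \<Longrightarrow> norm x \<ge> R \<Longrightarrow> f x = 0"
  shows "set_integrable lborel upper_half f" "(LINT x:upper_half|lborel. f x) = integral (half_box R) f"
proof -
  have c: "continuous_on (half_box R) f" using assms(1) half_box_subset continuous_on_subset by blast
  have z: "f x = 0" if "x \<in> upper_half - half_box R" for x
    using outside_half_box[OF that] that assms(2) by auto
  from LINT_eq_integral_compact[OF compact_cbox half_box_subset c z]
  show "set_integrable lborel upper_half f" "(LINT x:upper_half|lborel. f x) = integral (half_box R) f" by auto
qed

text \<open>Horizontal part of the divergence theorem: integrating along horizontal lines first, the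
  boundary values at distance \<open>R\<close> vanish. \<open>F\<close> needs a derivative only
  along these lines, which is all that is extracted later for the gradient of
  \<open>w\<close>.\<close>

lemma LINT_upper_half_horizontal_derivative:
  assumes D: "continuous_on upper_half D"
    and der: "\<And>x. x \<in> upper_half \<Longrightarrow> ((\<lambda>s. F (s, snd x)) has_real_derivative D x) (at (fst x))"
    and F0: "\<And>x. x \<in> upper_half \<Longrightarrow> norm x \<ge> R \<Longrightarrow> F x = 0"
    and D0: "\<And>x. x \<in> upper_half \<Longrightarrow> norm x \<ge> R \<Longrightarrow> D x = 0" and R: "R > 0"
  shows "(LINT x:upper_half|lborel. D x) = 0"
proof -
  have c: "continuous_on (half_box R) D" using D half_box_subset continuous_on_subset by blast
  have n: "norm (R, t) \<ge> R" "norm (- R, t) \<ge> R" for t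
    using norm_fst_le[of R t] norm_fst_le[of "- R" t] R by auto
  have in0: "integral (cbox (- R) R) (\<lambda>s. D (s, t)) = 0" if "t \<in> cbox 0 R" for t
  proof -
    have "((\<lambda>s. D (s, t)) has_integral F (R, t) - F (- R, t)) {- R..R}"
    proof (rule fundamental_theorem_of_calculus)
      fix s assume "s \<in> {- R..R}"
      have "((\<lambda>s. F (s, t)) has_real_derivative D (s, t)) (at s)"
        using der[of "(s, t)"] that by (simp add: upper_half_def)
      then show "((\<lambda>s. F (s, t)) has_vector_derivative D (s, t)) (at s within {- R..R})"
        by (metis has_real_derivative_iff_has_vector_derivative has_field_derivative_at_within)
    qed (use R in simp)
    moreover have "F (R, t) = 0" "F (- R, t) = 0" using that n by (auto intro!: F0 simp: upper_half_def)
    ultimately show ?thesis by (simp add: integral_unique)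
  qed
  have "(LINT x:upper_half|lborel. D x) = integral (half_box R) D"
    using D D0 by (rule LINT_upper_half(2))
  also have "\<dots> = integral (cbox (- R) R) (\<lambda>s. integral (cbox 0 R) (\<lambda>t. D (s, t)))"
    using c by (rule integral_prod_continuous)
  also have "\<dots> = integral (cbox 0 R) (\<lambda>t. integral (cbox (- R) R) (\<lambda>s. D (s, t)))"
    by (rule integral_swap_continuous) (use c in simp)
  also have "\<dots> = integral (cbox 0 R) (\<lambda>t. 0)" by (rule integral_cong) (rule in0)
  finally show ?thesis by simp
qed

text \<open>Vertical part of the divergence theorem: only the bottom edge contributes, with a minus
  sign because the outward normal points downwards. The derivative at the edge is one-sided.\<close>

lemma LINT_upper_half_vertical_derivative:
  assumes D: "continuous_on upper_half D"
    and der: "\<And>x. x \<in> upper_half \<Longrightarrow> ((\<lambda>t. F (fst x, t)) has_real_derivative D x) (at (snd x) within {0..})"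
    and F0: "\<And>x. x \<in> upper_half \<Longrightarrow> norm x \<ge> R \<Longrightarrow> F x = 0"
    and D0: "\<And>x. x \<in> upper_half \<Longrightarrow> norm x \<ge> R \<Longrightarrow> D x = 0" and R: "R > 0"
  shows "(LINT x:upper_half|lborel. D x) = - integral {- R..R} (\<lambda>s. F (s, 0))"
proof -
  have c: "continuous_on (half_box R) D" using D half_box_subset continuous_on_subset by blast
  have n: "norm (s, R) \<ge> R" for s
    using norm_snd_le[of R s] R by auto
  have inn: "integral (cbox 0 R) (\<lambda>t. D (s, t)) = - F (s, 0)" for s
  proof -
    have "((\<lambda>t. D (s, t)) has_integral F (s, R) - F (s, 0)) {0..R}"
    proof (rule fundamental_theorem_of_calculus)
      fix t assume "t \<in> {0..R}"
      then have "((\<lambda>t. F (s, t)) has_real_derivative D (s, t)) (at t within {0..R})"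
        using der[of "(s, t)"] by (auto simp: upper_half_def intro: has_field_derivative_subset)
      then show "((\<lambda>t. F (s, t)) has_vector_derivative D (s, t)) (at t within {0..R})"
        by (simp add: has_real_derivative_iff_has_vector_derivative)
    qed (use R in simp)
    moreover have "F (s, R) = 0" using R n by (auto intro!: F0 simp: upper_half_def)
    ultimately show ?thesis by (simp add: integral_unique)
  qed
  have "(LINT x:upper_half|lborel. D x) = integral (half_box R) D"
    using D D0 by (rule LINT_upper_half(2))
  also have "\<dots> = integral (cbox (- R) R) (\<lambda>s. integral (cbox 0 R) (\<lambda>t. D (s, t)))"
    using c by (rule integral_prod_continuous)
  also have "\<dots> = integral {- R..R} (\<lambda>s. - F (s, 0))" by (simp only: inn) simp
  finally show ?thesis by simp
qed

section \<open>From functions smooth up to the boundary to globally smooth test functions\<close>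

lemma continuous_on_two_open:
  assumes "open T1" "open T2" "S \<subseteq> T1 \<union> T2" "continuous_on (S \<inter> T1) f" "continuous_on (S \<inter> T2) f"
  shows "continuous_on S f"
proof -
  have "continuous_on (S \<inter> T1 \<union> S \<inter> T2) f"
    using assms by (intro continuous_on_Un_local_open) (auto simp: openin_open)
  moreover have "S \<inter> T1 \<union> S \<inter> T2 = S" using assms(3) by auto
  ultimately show ?thesis by simp
qed

text \<open>The natural test function is smooth only up to the boundary of the half-plane, whereas
  \<^const>\<open>test_fun\<close> asks for smoothness on the whole plane. Instead of extending it, shift it
  upwards by a small amount and cut it off below the boundary; this changes the form only slightly.\<close>

lemma negative_quad_form_upward_shift:
  fixes p p1 p2 V :: "real \<times> real \<Rightarrow> real" and B :: "real \<Rightarrow> real"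
  assumes cont: "continuous_on upper_half p" "continuous_on upper_half p1" "continuous_on upper_half p2"
    and V: "continuous_on (upper_half - {0}) V" and B: "continuous_on (- {0}) B"
    and sm: "\<And>k. Ck k {x. snd x > 0} p"
    and der: "\<And>x. snd x > 0 \<Longrightarrow> (p has_derivative (\<lambda>h. fst h * p1 x + snd h * p2 x)) (at x)"
    and supp: "\<And>x. x \<in> upper_half \<Longrightarrow> x \<notin> annulus a b \<Longrightarrow> p x = 0 \<and> p1 x = 0 \<and> p2 x = 0"
    and ab: "a' < a" "b < b'"
    and neg: "(LINT x:upper_half|lborel. (p1 x)\<^sup>2 + (p2 x)\<^sup>2 - V x * (p x)\<^sup>2) - (LINT s|lborel. B s * (p (s, 0))\<^sup>2) < 0"
  shows "\<exists>\<phi>. smooth_on UNIV \<phi> \<and> (\<forall>x. x \<notin> annulus a' b' \<longrightarrow> \<phi> x = 0) \<and> quad_form upper_half V B \<phi> < 0"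
proof -
  \<comment> \<open>Half the smaller of the two gaps in radius, so that shifts up to
    \<open>e0\<close> keep the support in the larger annulus.\<close>
  define e0 where "e0 = min (exp a - exp a') (exp b' - exp b) / 2"
  have e0: "e0 > 0" "exp a' + e0 < exp a" "exp b + e0 < exp b'" using ab 
    by (auto simp: e0_def min_def field_simps)
      (smt (verit) exp_less_cancel_iff)+
  define up where "up e x = x + (0, e)" for e :: real and x :: "real \<times> real"
  have up_upper: "up e x \<in> upper_half" if "e \<ge> 0" "x \<in> upper_half" for e x
    using that by (auto simp: up_def upper_half_def)
  have up0 [simp]: "up 0 x = x" for x by (simp add: up_def flip: zero_prod_def)
  have up_norm: "norm (up e x) \<le> norm x + e" "norm x \<le> norm (up e x) + e" if "e \<ge> 0" for e x
  proof -
    have n: "norm (0::real, e) = e" using that by (simp add: norm_Pair)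
    show "norm (up e x) \<le> norm x + e" unfolding up_def using norm_triangle_ineq[of x "(0, e)"] n by simp
    have "x = up e x - (0, e)" by (simp add: up_def)
    then show "norm x \<le> norm (up e x) + e" using norm_triangle_ineq4[of "up e x" "(0, e)"] n by simp
  qed
  have up_ann: "x \<in> annulus a' b'" if "up e x \<in> annulus a b" "0 \<le> e" "e \<le> e0" for e x
    using that up_norm[of e x] e0 by (auto simp: annulus_def)
  define R where "R = exp b' + 1"
  have R: "R > 0" by (simp add: R_def add_pos_pos)
  have up_zero: "p (up e x) = 0 \<and> p1 (up e x) = 0 \<and> p2 (up e x) = 0" 
    if "x \<notin> annulus a' b'" "x \<in> upper_half" "0 \<le> e" "e \<le> e0" for e x
    using that up_ann[of e x] up_upper supp by blast
  have far: "x \<notin> annulus a' b'" if "norm x \<ge> R" for x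
    using that by (auto simp: R_def annulus_def)
  \<comment> \<open>Only the test function is shifted, the potentials stay in place: these are the
    integrands of the original form at the shifted function.\<close>
  define f where "f e x = (p1 (up e x))\<^sup>2 + (p2 (up e x))\<^sup>2 - V x * (p (up e x))\<^sup>2" for e x
  define g where "g e s = B s * (p (s, e))\<^sup>2" for e s
  have cup: "continuous_on ({0..e0} \<times> upper_half) (\<lambda>z. q (up (fst z) (snd z)))" 
    if "continuous_on upper_half q" for q :: "real \<times> real \<Rightarrow> real"
    by (rule continuous_on_compose2[OF that])
       (auto simp: up_def upper_half_def intro!: continuous_intros)
  have cf: "continuous_on ({0..e0} \<times> upper_half) (\<lambda>z. f (fst z) (snd z))"
  proof -
    \<comment> \<open>\<open>V\<close> may be singular at the origin, but the shifted function
      vanishes on one ball around it for all shifts up to \<open>e0\<close>; continuity is checked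
      on that ball and off the origin separately.\<close>
    have "continuous_on ({0..e0} \<times> upper_half) (\<lambda>z. V (snd z) * (p (up (fst z) (snd z)))\<^sup>2)" (is "continuous_on ?S ?h")
    proof (rule continuous_on_two_open)
      show "open {z::real \<times> real \<times> real. snd z \<noteq> 0}" "open {z::real \<times> real \<times> real. norm (snd z) < exp a'}"
        by (intro open_Collect_neq open_Collect_less continuous_intros)+
      show "?S \<subseteq> {z. snd z \<noteq> 0} \<union> {z. norm (snd z) < exp a'}" by auto
      show "continuous_on (?S \<inter> {z. snd z \<noteq> 0}) ?h"
        by (intro continuous_on_mult continuous_on_power continuous_on_subset[OF cup[OF cont(1)]]
             continuous_on_compose2[OF V]) (auto intro: continuous_intros)
      have "?h z = 0" if "z \<in> ?S \<inter> {z. norm (snd z) < exp a'}" for z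
        using that up_zero[of "snd z" "fst z"] by (auto simp: annulus_def)
      then show "continuous_on (?S \<inter> {z. norm (snd z) < exp a'}) ?h"
        by (intro continuous_on_eq[OF continuous_on_const[of _ 0]]) (rule sym)
    qed
    then show ?thesis unfolding f_def by (intro continuous_on_diff continuous_on_add continuous_on_power cup cont)
  qed
  have cfe: "continuous_on upper_half (f e)" if "e \<in> {0..e0}" for e
  proof -
    have "(\<lambda>x. (e, x)) ` upper_half \<subseteq> {0..e0} \<times> upper_half" using that by auto
    from continuous_on_compose2[OF cf continuous_on_Pair[OF continuous_on_const continuous_on_id] this]
    show ?thesis by simp
  qed
  have cg: "continuous_on ({0..e0} \<times> UNIV) (\<lambda>z. g (fst z) (snd z))" (is "continuous_on ?S ?h")
  proof (rule continuous_on_two_open)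
    show "open {z::real \<times> real. snd z \<noteq> 0}" "open {z::real \<times> real. \<bar>snd z\<bar> < exp a'}"
      by (intro open_Collect_neq open_Collect_less continuous_intros)+
    show "?S \<subseteq> {z. snd z \<noteq> 0} \<union> {z. \<bar>snd z\<bar> < exp a'}" by auto
    show "continuous_on (?S \<inter> {z. snd z \<noteq> 0}) ?h" unfolding g_def
      by (intro continuous_on_mult continuous_on_power continuous_on_compose2[OF B] continuous_on_compose2[OF cont(1)])
         (auto intro!: continuous_intros simp: upper_half_def)
    have "?h z = 0" if "z \<in> ?S \<inter> {z. \<bar>snd z\<bar> < exp a'}" for z
      using that up_zero[of "(snd z, 0)" "fst z"] by (auto simp: annulus_def up_def upper_half_def norm_Pair g_def)
    then show "continuous_on (?S \<inter> {z. \<bar>snd z\<bar> < exp a'}) ?h"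
      by (intro continuous_on_eq[OF continuous_on_const[of _ 0]]) (rule sym)
  qed
  have cge: "continuous_on UNIV (g e)" if "e \<in> {0..e0}" for e
  proof -
    have "(\<lambda>x. (e, x)) ` UNIV \<subseteq> {0..e0} \<times> UNIV" using that by auto
    from continuous_on_compose2[OF cg continuous_on_Pair[OF continuous_on_const continuous_on_id] this]
    show ?thesis by simp
  qed
  have f0: "f e x = 0" if "e \<in> {0..e0}" "x \<in> upper_half" "norm x \<ge> R" for e x
    using up_zero[of x e] far[of x] that by (simp add: f_def)
  have g0: "g e s = 0" if "e \<in> {0..e0}" "\<bar>s\<bar> \<ge> R" for e s
    using up_zero[of "(s, 0)" e] far[of "(s, 0)"] that by (simp add: g_def up_def upper_half_def norm_Pair)
  \<comment> \<open>Joint continuity in shift and position makes \<open>J\<close> continuous on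
    \<open>{0..e0}\<close>. As \<open>J 0\<close> is the negative value assumed in
    \<open>neg\<close>, some positive shift keeps it negative.\<close>
  define J where "J e = integral (half_box R) (f e) - integral (cbox (- R) R) (g e)" for e
  have J: "(LINT x:upper_half|lborel. f e x) - (LINT s|lborel. g e s) = J e" if "e \<in> {0..e0}" for e
  proof -
    have "(LINT x:upper_half|lborel. f e x) = integral (half_box R) (f e)"
      using f0[OF that] by (intro LINT_upper_half(2) cfe that)
    moreover have "(LINT s:UNIV|lborel. g e s) = integral (cbox (- R) R) (g e)"
      using g0[OF that] by (intro LINT_eq_integral_compact(2) continuous_on_subset[OF cge[OF that]]) auto
    ultimately show ?thesis by (simp add: J_def set_lebesgue_integral_def)
  qed
  have cJ: "continuous_on {0..e0} J" unfolding J_def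
    by (intro continuous_on_diff integral_continuous_on_param)
       (auto intro!: continuous_on_subset[OF cf] continuous_on_subset[OF cg] simp: case_prod_beta' half_box_subset[THEN subsetD])
  have "J 0 < 0" using neg J[of 0] e0 by (simp add: f_def g_def)
  moreover have "(J \<longlongrightarrow> J 0) (at 0 within {0..e0})" using cJ e0 by (auto simp: continuous_on_def)
  ultimately have "\<forall>\<^sub>F e in at 0 within {0..e0}. J e < 0" by (intro order_tendstoD)
  moreover have "at (0::real) within {0..e0} \<noteq> bot" using e0 by (simp add: at_within_Icc_at_right)
  ultimately obtain e where e: "e \<in> {0..e0}" "e \<noteq> 0" "J e < 0"
    using eventually_happens'[of "at 0 within {0..e0}" "\<lambda>e. e \<in> {0..e0} \<and> e \<noteq> 0 \<and> J e < 0"]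
    by (auto simp: eventually_at_filter elim: eventually_mono)
  then have epos: "e > 0" by auto
  \<comment> \<open>The argument of the step is 0 at height \<open>- e / 2\<close> and 1 at height
    \<open>- e / 4\<close>. The cutoff thus equals 1 near the closed half-plane and vanishes before
    height \<open>- e\<close>, below which the shifted function is not known to be smooth.\<close>
  define \<kappa> where "\<kappa> x = smooth_step (4 / e * snd x + 2)" for x :: "real \<times> real"
  define \<phi> where "\<phi> x = p (up e x) * \<kappa> x" for x
  have k1: "\<kappa> x = 1" if "snd x > - e / 4" for x 
    using that epos unfolding \<kappa>_def by (intro smooth_step_simps) (auto simp: field_simps)
  have k0: "\<kappa> x = 0" if "snd x < - e / 2" for x 
    using that epos unfolding \<kappa>_def by (intro smooth_step_simps) (auto simp: field_simps)
  have "smooth_on UNIV \<phi>" unfolding smooth_on_def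
  proof
    fix k
    have "Ck k {x. snd x > - e} (\<lambda>x. p (up e x))"
      using Ck_shift[OF sm[of k], of "(0, e)"] by (rule Ck_subset[OF Ck_cong]) (auto simp: up_def)
    then have "Ck k {x. snd x > - e} \<phi>" unfolding \<phi>_def \<kappa>_def
      by (intro Ck_mult Ck_smooth_step Ck_add Ck_const Ck_snd)
    moreover have "Ck k {x. snd x < - e / 2} \<phi>"
      using Ck_const[of k _ 0] by (rule Ck_cong) (simp add: \<phi>_def k0)
    moreover have "open {x::real\<times>real. snd x > - e}" "open {x::real\<times>real. snd x < - e / 2}"
      by (intro open_Collect_less continuous_intros)+
    ultimately have "Ck k ({x. snd x > - e} \<union> {x. snd x < - e / 2}) \<phi>"
      by (intro Ck_Un_open)
    moreover have "{x::real\<times>real. snd x > - e} \<union> {x. snd x < - e / 2} = UNIV" using epos by auto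
    ultimately show "Ck k UNIV \<phi>" by simp
  qed
  moreover have "\<phi> x = 0" if "x \<notin> annulus a' b'" for x
  proof (cases "snd x < - e / 2")
    case False
    then have "up e x \<in> upper_half" using epos by (simp add: up_def upper_half_def)
    moreover have "up e x \<notin> annulus a b" using up_ann[of e x] that e by auto
    ultimately show ?thesis using supp by (simp add: \<phi>_def)
  qed (simp add: \<phi>_def k0)
  moreover have "quad_form upper_half V B \<phi> < 0"
  proof -
    have eq: "\<phi> x = p (up e x)" if "snd x > - e / 4" for x using k1[OF that] by (simp add: \<phi>_def)
    have d: "d1 \<phi> x = p1 (up e x) \<and> d2 \<phi> x = p2 (up e x)" if "x \<in> upper_half" for x
    proof -
      have pos: "snd (up e x) > 0" using that epos by (simp add: up_def upper_half_def add_nonneg_pos)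
      have "(up e has_derivative (\<lambda>h. h)) (at x)" unfolding up_def[abs_def]
        by (auto intro!: derivative_eq_intros)
      from has_derivative_compose[OF this der[OF pos]]
      have "((\<lambda>x. p (up e x)) has_derivative (\<lambda>h. fst h * p1 (up e x) + snd h * p2 (up e x))) (at x)" .
      then have "(\<phi> has_derivative (\<lambda>h. fst h * p1 (up e x) + snd h * p2 (up e x))) (at x)"
        by (rule has_derivative_transform_within_open[where s = "{x. snd x > - e / 4}"])
           (use that epos eq in \<open>auto intro!: open_Collect_less continuous_intros simp: upper_half_def\<close>)
      from d1_d2_eq[OF this] show ?thesis by simp
    qed
    have "(LINT x:upper_half|lborel. (d1 \<phi> x)\<^sup>2 + (d2 \<phi> x)\<^sup>2 - V x * (\<phi> x)\<^sup>2) = (LINT x:upper_half|lborel. f e x)"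
      using d eq epos unfolding set_lebesgue_integral_def
      by (intro Bochner_Integration.integral_cong refl) (auto simp: indicator_def f_def upper_half_def)
    moreover have "B s * (\<phi> (s, 0))\<^sup>2 = g e s" for s
      using eq[of "(s, 0)"] epos by (simp add: g_def up_def)
    ultimately show ?thesis using J[OF e(1)] e(3) by (simp add: quad_form_def)
  qed
  ultimately show ?thesis by blast
qed

subsection \<open>The half-plane\<close>

text \<open>Horizontal lines through the point stay in the closed half-plane, so the first partial
  is two-sided; the second is one-sided on the boundary.\<close>

lemma upper_half_partials:
  assumes "(f has_derivative (\<lambda>h. fst h * a + snd h * b)) (at x within upper_half)" "x \<in> upper_half"
  shows "((\<lambda>s. f (s, snd x)) has_real_derivative a) (at (fst x))"
    and "((\<lambda>t. f (fst x, t)) has_real_derivative b) (at (snd x) within {0..})"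
proof -
  have 1: "((\<lambda>s. (s, snd x)) has_derivative (\<lambda>h. (h, 0))) (at (fst x) within UNIV)"
    by (auto intro!: derivative_eq_intros)
  have "(f has_derivative (\<lambda>h. fst h * a + snd h * b)) (at (fst x, snd x) within (\<lambda>s. (s, snd x)) ` UNIV)"
    using assms by (auto intro: has_derivative_subset simp: upper_half_def)
  from has_derivative_in_compose[OF 1 this]
  show "((\<lambda>s. f (s, snd x)) has_real_derivative a) (at (fst x))"
    by (simp add: has_field_derivative_def mult_commute_abs)
  have 2: "((\<lambda>t. (fst x, t)) has_derivative (\<lambda>h. (0, h))) (at (snd x) within {0..})"
    by (auto intro!: derivative_eq_intros)
  have "(f has_derivative (\<lambda>h. fst h * a + snd h * b)) (at (fst x, snd x) within (\<lambda>t. (fst x, t)) ` {0..})"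
    using assms by (auto intro: has_derivative_subset simp: upper_half_def)
  from has_derivative_in_compose[OF 2 this]
  show "((\<lambda>t. f (fst x, t)) has_real_derivative b) (at (snd x) within {0..})"
    by (simp add: has_field_derivative_def mult_commute_abs)
qed

lemma at_within_upper_half_Diff:
  assumes "x \<noteq> 0"
  shows "at x within (upper_half - {0}) = at x within upper_half"
  by (rule at_within_nhd[of x "- {0}"]) (use assms in auto)

text \<open>Derivatives within the closed half-plane replace \<open>d1\<close> and
  \<open>d2\<close>, which are two-sided and hence unsuitable on the boundary. The equation reaches
  the boundary by continuity of the second derivatives, and the boundary condition identifies
  \<open>v2\<close> by uniqueness of one-sided derivatives.\<close>

lemma half_solution_jet:
  assumes sol: "sol_half K0 \<beta> h0 v"
  obtains v1 v2 v11 v22 where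
    "\<And>x. x \<in> upper_half - {0} \<Longrightarrow> (v has_derivative (\<lambda>h. fst h * v1 x + snd h * v2 x)) (at x within upper_half)"
    "\<And>x. x \<in> upper_half - {0} \<Longrightarrow> ((\<lambda>s. v1 (s, snd x)) has_real_derivative v11 x) (at (fst x))"
    "\<And>x. x \<in> upper_half - {0} \<Longrightarrow> ((\<lambda>t. v2 (fst x, t)) has_real_derivative v22 x) (at (snd x) within {0..})"
    "continuous_on (upper_half - {0}) v" "continuous_on (upper_half - {0}) v1" "continuous_on (upper_half - {0}) v2"
    "continuous_on (upper_half - {0}) v11" "continuous_on (upper_half - {0}) v22"
    "\<And>x. x \<in> upper_half - {0} \<Longrightarrow> v11 x + v22 x = - (2 * K0 * (norm x powr (2*\<beta>) * exp (v x)))"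
    "\<And>s. s \<noteq> 0 \<Longrightarrow> v2 (s, 0) = - (2 * h0 * \<bar>s\<bar> powr \<beta> * exp (v (s, 0) / 2))"
proof -
  define U where "U = upper_half - {0}"
  have Ck: "Ck (Suc (Suc 0)) U v" using sol by (simp add: sol_half_def smooth_on_def U_def)
  then have cv: "continuous_on U v" by (rule Ck_imp_continuous)
  from Ck obtain v1 v2 where v: "\<forall>x\<in>U. (v has_derivative (\<lambda>h. fst h * v1 x + snd h * v2 x)) (at x within U)"
    and C1: "Ck (Suc 0) U v1" "Ck (Suc 0) U v2" by (subst (asm) Ck.simps) blast
  then have c1: "continuous_on U v1" "continuous_on U v2" using Ck_imp_continuous by blast+
  from C1(1) obtain v11 v12 where v1: "\<forall>x\<in>U. (v1 has_derivative (\<lambda>h. fst h * v11 x + snd h * v12 x)) (at x within U)"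
    and c11: "continuous_on U v11" by auto
  from C1(2) obtain v21 v22 where v2: "\<forall>x\<in>U. (v2 has_derivative (\<lambda>h. fst h * v21 x + snd h * v22 x)) (at x within U)"
    and c22: "continuous_on U v22" by auto
  have wi: "at x within U = at x within upper_half" if "x \<in> U" for x
    using that at_within_upper_half_Diff[of x] by (simp add: U_def)
  have dv: "(v has_derivative (\<lambda>h. fst h * v1 x + snd h * v2 x)) (at x within upper_half)"
    and dv1: "(v1 has_derivative (\<lambda>h. fst h * v11 x + snd h * v12 x)) (at x within upper_half)"
    and dv2: "(v2 has_derivative (\<lambda>h. fst h * v21 x + snd h * v22 x)) (at x within upper_half)"
    if "x \<in> U" for x using v v1 v2 wi that by auto
  let ?O = "{x::real\<times>real. snd x > 0}"
  have opn: "open ?O" by (intro open_Collect_less continuous_intros)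
  have sub: "?O \<subseteq> upper_half" "?O \<subseteq> U" by (auto simp: U_def upper_half_def)
  have at: "(f has_derivative f') (at x)" if "(f has_derivative f') (at x within upper_half)" "x \<in> ?O" for f :: "real\<times>real \<Rightarrow> real" and f' x
    using has_derivative_subset[OF that(1) sub(1)] at_within_open[OF that(2) opn] by simp
  \<comment> \<open>The defect of the equation: zero in the open half-plane and continuous up to the
    boundary away from the origin.\<close>
  define h where "h x = v11 x + v22 x + 2 * K0 * (norm x powr (2*\<beta>) * exp (v x))" for x
  have h0: "h x = 0" if x: "x \<in> ?O" for x
  proof -
    have e: "d1 v y = v1 y" "d2 v y = v2 y" if "y \<in> ?O" for y
      using d1_d2_eq[OF at[OF dv that]] that sub by auto
    have "(d1 v has_derivative (\<lambda>h. fst h * v11 x + snd h * v12 x)) (at x)"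
      by (rule has_derivative_transform_within_open[OF at[OF dv1 x] opn x]) (use x sub e in auto)
    from d1_d2_eq(1)[OF this] have 1: "d1 (d1 v) x = v11 x" .
    have "(d2 v has_derivative (\<lambda>h. fst h * v21 x + snd h * v22 x)) (at x)"
      by (rule has_derivative_transform_within_open[OF at[OF dv2 x] opn x]) (use x sub e in auto)
    from d1_d2_eq(2)[OF this] have 2: "d2 (d2 v) x = v22 x" .
    have "- lap v x = 2 * K0 * norm x powr (2*\<beta>) * exp (v x)"
      using sol x by (cases x) (auto simp: sol_half_def)
    then show ?thesis using 1 2 by (simp add: lap_def h_def)
  qed
  have ch: "continuous_on U h" unfolding h_def
    by (intro continuous_intros c11 c22 cv) (auto simp: U_def)
  have h0': "h (s, 0) = 0" if "s \<noteq> 0" for s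
  proof -
    have "continuous_on {0..} (\<lambda>t. h (s, t))"
      by (rule continuous_on_compose2[OF ch]) (use that in \<open>auto intro!: continuous_intros simp: U_def upper_half_def zero_prod_def\<close>)
    then have "((\<lambda>t. h (s, t)) \<longlongrightarrow> h (s, 0)) (at 0 within {0..})" by (auto simp: continuous_on_def)
    then have "((\<lambda>t. h (s, t)) \<longlongrightarrow> h (s, 0)) (at_right 0)" by (rule tendsto_within_subset) auto
    moreover have "((\<lambda>t. h (s, t)) \<longlongrightarrow> 0) (at_right 0)"
      by (rule tendsto_eventually) (auto simp: eventually_at_filter h0)
    ultimately show ?thesis by (rule tendsto_unique[rotated]) simp
  qed
  have hU: "h x = 0" if "x \<in> U" for x
  proof (cases "snd x > 0")
    case False
    then have "x = (fst x, 0)" "fst x \<noteq> 0" using that 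
      by (auto simp: U_def upper_half_def prod_eq_iff)
    then show ?thesis using h0' by metis
  qed (simp add: h0)
  show ?thesis
  proof (rule that[of v1 v2 v11 v22])
    fix x assume "x \<in> upper_half - {0}"
    then have x: "x \<in> U" "x \<in> upper_half" by (auto simp: U_def)
    show "(v has_derivative (\<lambda>h. fst h * v1 x + snd h * v2 x)) (at x within upper_half)" by (rule dv[OF x(1)])
    show "((\<lambda>s. v1 (s, snd x)) has_real_derivative v11 x) (at (fst x))"
      by (rule upper_half_partials(1)[OF dv1[OF x(1)] x(2)])
    show "((\<lambda>t. v2 (fst x, t)) has_real_derivative v22 x) (at (snd x) within {0..})"
      by (rule upper_half_partials(2)[OF dv2[OF x(1)] x(2)])
    show "v11 x + v22 x = - (2 * K0 * (norm x powr (2*\<beta>) * exp (v x)))"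
      using hU[OF x(1)] by (simp add: h_def)
  next
    fix s :: real assume s: "s \<noteq> 0"
    then have x: "(s, 0) \<in> U" "(s, 0) \<in> upper_half" by (auto simp: U_def upper_half_def zero_prod_def)
    have "((\<lambda>t. v (s, t)) has_real_derivative v2 (s, 0)) (at 0 within {0..})"
      using upper_half_partials(2)[OF dv[OF x(1)] x(2)] by simp
    then have "((\<lambda>t. v (s, t)) has_real_derivative v2 (s, 0)) (at_right 0)"
      by (rule has_field_derivative_subset) auto
    moreover have "((\<lambda>t. v (s, t)) has_real_derivative (- (2 * h0 * \<bar>s\<bar> powr \<beta> * exp (v (s, 0) / 2)))) (at_right 0)"
      using sol s by (simp add: sol_half_def)
    ultimately show "v2 (s, 0) = - (2 * h0 * \<bar>s\<bar> powr \<beta> * exp (v (s, 0) / 2))"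
      unfolding has_field_derivative_iff by (rule tendsto_unique[rotated]) simp
  qed (use cv c1 c11 c22 in \<open>simp_all add: U_def\<close>)
qed

text \<open>The two derivatives are opposite: this is the harmonicity of \<open>ln |x|\<close>, by
  which \<open>w\<close> has the Laplacian of \<open>v / 2\<close>.\<close>

lemma DERIV_ln_norm_gradient:
  fixes x :: "real \<times> real"
  assumes "x \<noteq> 0"
  shows "((\<lambda>s. s / (norm (s, snd x))\<^sup>2) has_real_derivative ((snd x)\<^sup>2 - (fst x)\<^sup>2) / ((norm x)\<^sup>2)\<^sup>2) (at (fst x))"
    and "((\<lambda>t. t / (norm (fst x, t))\<^sup>2) has_real_derivative ((fst x)\<^sup>2 - (snd x)\<^sup>2) / ((norm x)\<^sup>2)\<^sup>2) (at (snd x) within T)"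
proof -
  have pos: "(fst x)\<^sup>2 + (snd x)\<^sup>2 \<noteq> 0"
    using assms norm_sq[of x] by (metis norm_eq_zero power_eq_0_iff)
  show "((\<lambda>s. s / (norm (s, snd x))\<^sup>2) has_real_derivative ((snd x)\<^sup>2 - (fst x)\<^sup>2) / ((norm x)\<^sup>2)\<^sup>2) (at (fst x))"
    unfolding norm_sq using pos
    by (auto intro!: derivative_eq_intros simp: power2_eq_square algebra_simps)
  show "((\<lambda>t. t / (norm (fst x, t))\<^sup>2) has_real_derivative ((fst x)\<^sup>2 - (snd x)\<^sup>2) / ((norm x)\<^sup>2)\<^sup>2) (at (snd x) within T)"
    unfolding norm_sq using pos
    by (auto intro!: derivative_eq_intros simp: power2_eq_square algebra_simps)
qed

text \<open>The case \<open>p = P \<eta>\<^sup>2\<close>, \<open>P = exp w\<close>, \<open>\<nabla>w = (a, b)\<close>, \<open>\<nabla>\<eta> = (g, h)\<close>, \<open>w\<^sub>s\<^sub>s = c\<close>, \<open>\<Delta>w = - K W\<close>;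
  the two subtracted brackets add up to the divergence of \<open>p\<^sup>2 \<nabla>w\<close>.\<close>

lemma weighted_energy_identity:
  fixes P a b \<eta> g h K W c :: real
  shows "(P * (a * \<eta>\<^sup>2 + 2 * \<eta> * g))\<^sup>2 + (P * (b * \<eta>\<^sup>2 + 2 * \<eta> * h))\<^sup>2 - 2 * K * W * (P * \<eta>\<^sup>2)\<^sup>2
    - (2 * (P * \<eta>\<^sup>2) * (P * (a * \<eta>\<^sup>2 + 2 * \<eta> * g)) * a + (P * \<eta>\<^sup>2)\<^sup>2 * c)
    - (2 * (P * \<eta>\<^sup>2) * (P * (b * \<eta>\<^sup>2 + 2 * \<eta> * h)) * b + (P * \<eta>\<^sup>2)\<^sup>2 * (- K * W - c))
    = P\<^sup>2 * (4 * \<eta>\<^sup>2 * (g\<^sup>2 + h\<^sup>2) - K * W * (\<eta>\<^sup>2)\<^sup>2 - (a\<^sup>2 + b\<^sup>2) * (\<eta>\<^sup>2)\<^sup>2)"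
  by (simp add: algebra_simps power2_eq_square)

text \<open>\<open>neg\<close> says exactly that the upper bound for the form at
  \<open>exp w * \<eta>^2\<close> is negative. The margins between the two annuli are spent on
  passing from this function, controlled only on the half-plane, to a globally smooth one.\<close>

lemma half_negative_test_fun:
  fixes v :: "real \<times> real \<Rightarrow> real"
  assumes K0: "K0 > 0" and sol: "sol_half K0 \<beta> h0 v"
    and \<eta>: "smooth_on UNIV \<eta>" "\<And>x. x \<notin> annulus a b \<Longrightarrow> \<eta> x = 0"
    and ab: "a' < a" "b < b'"
    and W_def: "W = (\<lambda>x. norm x powr (2*\<beta>) * exp (v x))"
    and neg: "8 / K0 * (LINT x:upper_half|lborel. (norm x)\<^sup>2 * ((d1 \<eta> x)\<^sup>2 + (d2 \<eta> x)\<^sup>2)\<^sup>2)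
       < K0 / 2 * (LINT x:upper_half|lborel. (norm x)\<^sup>2 * (W x)\<^sup>2 * \<eta> x ^ 4)"
  shows "\<exists>\<phi>. smooth_on UNIV \<phi> \<and> (\<forall>x. x \<notin> annulus a' b' \<longrightarrow> \<phi> x = 0) \<and>
     quad_form upper_half (\<lambda>x. 2 * K0 * W x) (\<lambda>s. h0 * \<bar>s\<bar> powr \<beta> * exp (v (s, 0) / 2)) \<phi> < 0"
proof -
  obtain v1 v2 v11 v22 where
    dv: "\<And>x. x \<in> upper_half - {0} \<Longrightarrow> (v has_derivative (\<lambda>h. fst h * v1 x + snd h * v2 x)) (at x within upper_half)"
    and dv1: "\<And>x. x \<in> upper_half - {0} \<Longrightarrow> ((\<lambda>s. v1 (s, snd x)) has_real_derivative v11 x) (at (fst x))"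
    and dv2: "\<And>x. x \<in> upper_half - {0} \<Longrightarrow> ((\<lambda>t. v2 (fst x, t)) has_real_derivative v22 x) (at (snd x) within {0..})"
    and cv: "continuous_on (upper_half - {0}) v" "continuous_on (upper_half - {0}) v1" "continuous_on (upper_half - {0}) v2"
      "continuous_on (upper_half - {0}) v11" "continuous_on (upper_half - {0}) v22"
    and lapv: "\<And>x. x \<in> upper_half - {0} \<Longrightarrow> v11 x + v22 x = - (2 * K0 * (norm x powr (2*\<beta>) * exp (v x)))"
    and bdv: "\<And>s. s \<noteq> 0 \<Longrightarrow> v2 (s, 0) = - (2 * h0 * \<bar>s\<bar> powr \<beta> * exp (v (s, 0) / 2))"
    by (rule half_solution_jet[OF sol]) (rule that)
  define U where "U = upper_half - {0}"
  define w where "w x = v x / 2 + (\<beta> + 1) * ln (norm x)" for x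
  define w1 where "w1 x = v1 x / 2 + (\<beta> + 1) * (fst x / (norm x)\<^sup>2)" for x
  define w2 where "w2 x = v2 x / 2 + (\<beta> + 1) * (snd x / (norm x)\<^sup>2)" for x
  define w11 where "w11 x = v11 x / 2 + (\<beta> + 1) * (((snd x)\<^sup>2 - (fst x)\<^sup>2) / ((norm x)\<^sup>2)\<^sup>2)" for x
  define w22 where "w22 x = v22 x / 2 + (\<beta> + 1) * (((fst x)\<^sup>2 - (snd x)\<^sup>2) / ((norm x)\<^sup>2)\<^sup>2)" for x
  define \<eta>1 where "\<eta>1 = d1 \<eta>"
  define \<eta>2 where "\<eta>2 = d2 \<eta>"
  define V where "V x = 2 * K0 * W x" for x
  define B where "B s = h0 * \<bar>s\<bar> powr \<beta> * exp (v (s, 0) / 2)" for s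
  note c\<eta> = smooth_C1(2-4)[OF \<eta>(1), folded \<eta>1_def \<eta>2_def]
  have d\<eta>: "(\<eta> has_derivative (\<lambda>h. fst h * \<eta>1 x + snd h * \<eta>2 x)) (at x within S)" for x S
    using smooth_C1(1)[OF \<eta>(1), folded \<eta>1_def \<eta>2_def] by (rule has_derivative_at_withinI)
  have out: "\<eta> x = 0" "\<eta>1 x = 0" "\<eta>2 x = 0" if "x \<notin> annulus a b" for x
    using \<eta>(2) partials_zero_outside[OF closed_annulus \<eta>(2) that] that by (auto simp: \<eta>1_def \<eta>2_def)
  define R where "R = exp b + 1"
  have R: "R > 0" by (simp add: R_def add_pos_pos)
  have far: "x \<notin> annulus a b" if "norm x \<ge> R" for x using that by (auto simp: R_def annulus_def)
  have near: "x \<notin> annulus a b" if "norm x < exp a" for x using that by (auto simp: annulus_def)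
  \<comment> \<open>This local fact shadows the extensionality rule; \<open>rule ext\<close> below
    refers to it. It carries continuity across the origin for functions that vanish near it.\<close>
  have ext: "continuous_on upper_half f" if "continuous_on U f" "\<And>x. norm x < exp a \<Longrightarrow> f x = 0" for f :: "real \<times> real \<Rightarrow> real"
  proof (rule continuous_on_two_open)
    show "open (- {0::real\<times>real})" "open (ball (0::real\<times>real) (exp a))" by auto
    show "upper_half \<subseteq> - {0} \<union> ball 0 (exp a)" by auto
    show "continuous_on (upper_half \<inter> - {0}) f" using that(1) by (simp add: U_def Diff_eq)
    show "continuous_on (upper_half \<inter> ball 0 (exp a)) f"
      by (rule continuous_on_eq[OF continuous_on_const[of _ 0]]) (use that(2) in auto)
  qed
  have c\<eta>U: "continuous_on U \<eta>" "continuous_on U \<eta>1" "continuous_on U \<eta>2"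
    using c\<eta> continuous_on_subset by blast+
  have cU: "continuous_on U w" "continuous_on U w1" "continuous_on U w2" "continuous_on U w11" "continuous_on U w22" "continuous_on U W"
    unfolding w_def w1_def w2_def w11_def w22_def W_def
    by (intro continuous_intros cv[folded U_def]; simp add: U_def)+
  define P where "P x = exp (w x)" for x
  have cP: "continuous_on U P" unfolding P_def by (intro continuous_intros cU)
  \<comment> \<open>The identity for which the coefficient \<open>\<beta> + 1\<close> in
    \<open>w\<close> is chosen.\<close>
  have P2: "(P x)\<^sup>2 = (norm x)\<^sup>2 * W x" if "x \<noteq> 0" for x
  proof -
    have "(P x)\<^sup>2 = exp (2 * w x)" by (simp add: P_def exp_double)
    also have "2 * w x = v x + 2 * \<beta> * ln (norm x) + 2 * ln (norm x)" by (simp add: w_def algebra_simps)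
    also have "exp \<dots> = exp (v x) * exp (2 * \<beta> * ln (norm x)) * (norm x)\<^sup>2"
      using that by (simp add: exp_add exp_double)
    finally show ?thesis using that by (simp add: W_def powr_def)
  qed
  have dw: "(w has_derivative (\<lambda>h. fst h * w1 x + snd h * w2 x)) (at x within upper_half)" if "x \<in> U" for x
  proof -
    have "x \<noteq> 0" using that by (simp add: U_def)
    then have "((\<lambda>x. (1 / 2) * v x + (\<beta> + 1) * ln (norm x)) has_derivative
       (\<lambda>h. (1 / 2) * (fst h * v1 x + snd h * v2 x) + 
         (\<beta> + 1) * (fst h * (fst x / (norm x)\<^sup>2) + snd h * (snd x / (norm x)\<^sup>2)))) (at x within upper_half)"
      using that by (intro has_derivative_add has_derivative_mult_right has_derivative_ln_norm dv) (auto simp: U_def)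
    then have "((\<lambda>x. (1 / 2) * v x + (\<beta> + 1) * ln (norm x)) has_derivative
       (\<lambda>h. fst h * w1 x + snd h * w2 x)) (at x within upper_half)"
      by (rule has_derivative_eq_rhs) (simp add: w1_def w2_def fun_eq_iff algebra_simps)
    moreover have "(\<lambda>x. (1 / 2) * v x + (\<beta> + 1) * ln (norm x)) = w" by (simp add: w_def fun_eq_iff)
    ultimately show ?thesis by simp
  qed
  have lapw: "w11 x + w22 x = - K0 * W x" if "x \<in> U" for x
  proof -
    have "w11 x + w22 x = (v11 x + v22 x) / 2"
      by (simp add: w11_def w22_def diff_divide_distrib algebra_simps)
    then show ?thesis using lapv that by (simp add: U_def W_def)
  qed
  have dw1: "((\<lambda>s. w1 (s, snd x)) has_real_derivative w11 x) (at (fst x))" if "x \<in> U" for x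
  proof -
    have "x \<noteq> 0" using that by (simp add: U_def)
    have "((\<lambda>s. v1 (s, snd x) / 2 + (\<beta> + 1) * (s / (norm (s, snd x))\<^sup>2)) has_real_derivative w11 x) (at (fst x))"
      unfolding w11_def using that
      by (intro DERIV_add DERIV_cdivide DERIV_cmult DERIV_ln_norm_gradient dv1 \<open>x \<noteq> 0\<close>) (auto simp: U_def)
    then show ?thesis by (simp add: w1_def)
  qed
  have dw2: "((\<lambda>t. w2 (fst x, t)) has_real_derivative w22 x) (at (snd x) within {0..})" if "x \<in> U" for x
  proof -
    have "x \<noteq> 0" using that by (simp add: U_def)
    have "((\<lambda>t. v2 (fst x, t) / 2 + (\<beta> + 1) * (t / (norm (fst x, t))\<^sup>2)) has_real_derivative w22 x) (at (snd x) within {0..})"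
      unfolding w22_def using that
      by (intro DERIV_add DERIV_cdivide DERIV_cmult DERIV_ln_norm_gradient dv2 \<open>x \<noteq> 0\<close>) (auto simp: U_def)
    then show ?thesis by (simp add: w2_def)
  qed
  define p where "p x = P x * (\<eta> x)\<^sup>2" for x
  define p1 where "p1 x = P x * (w1 x * (\<eta> x)\<^sup>2 + 2 * \<eta> x * \<eta>1 x)" for x
  define p2 where "p2 x = P x * (w2 x * (\<eta> x)\<^sup>2 + 2 * \<eta> x * \<eta>2 x)" for x
  define F1 where "F1 x = (p x)\<^sup>2 * w1 x" for x
  define F2 where "F2 x = (p x)\<^sup>2 * w2 x" for x
  \<comment> \<open>\<open>D1\<close> and \<open>D2\<close> are the two terms of the divergence of
    \<open>p^2 grad w\<close>.\<close>
  define D1 where "D1 x = 2 * p x * p1 x * w1 x + (p x)\<^sup>2 * w11 x" for x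
  define D2 where "D2 x = 2 * p x * p2 x * w2 x + (p x)\<^sup>2 * w22 x" for x
  define A where "A x = (p1 x)\<^sup>2 + (p2 x)\<^sup>2 - V x * (p x)\<^sup>2" for x
  define X where "X x = (norm x)\<^sup>2 * ((\<eta>1 x)\<^sup>2 + (\<eta>2 x)\<^sup>2)\<^sup>2" for x
  define Y where "Y x = (norm x)\<^sup>2 * (W x)\<^sup>2 * \<eta> x ^ 4" for x
  have out': "p x = 0" "p1 x = 0" "p2 x = 0" "F1 x = 0" "F2 x = 0" "D1 x = 0" "D2 x = 0" "A x = 0" "X x = 0" "Y x = 0"
    if "x \<notin> annulus a b" for x
    using out[OF that] by (simp_all add: p_def p1_def p2_def F1_def F2_def D1_def D2_def A_def X_def Y_def)
  have cpU: "continuous_on U p" "continuous_on U p1" "continuous_on U p2"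
    unfolding p_def p1_def p2_def by (intro continuous_intros cP c\<eta>U cU)+
  have cont: "continuous_on upper_half p" "continuous_on upper_half p1" "continuous_on upper_half p2"
    "continuous_on upper_half F2" "continuous_on upper_half D1" "continuous_on upper_half D2" "continuous_on upper_half A"
    "continuous_on upper_half X" "continuous_on upper_half Y"
    unfolding F2_def D1_def D2_def A_def X_def Y_def V_def
    by (rule ext, intro continuous_intros cpU cU c\<eta>U,
        use out' near in \<open>simp add: F2_def D1_def D2_def A_def X_def Y_def V_def\<close>)+
  have dpU: "(p has_derivative (\<lambda>h. fst h * p1 x + snd h * p2 x)) (at x within upper_half)" if "x \<in> U" for x
    unfolding p_def[abs_def] P_def[abs_def]
    using has_derivative_mult[OF has_derivative_exp[OF dw[OF that]] has_derivative_power[OF d\<eta>, where n = 2]]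
    by (rule has_derivative_eq_rhs)
       (simp add: p1_def p2_def P_def fun_eq_iff algebra_simps)
  have dp: "(p has_derivative (\<lambda>h. fst h * p1 x + snd h * p2 x)) (at x)" if "snd x > 0" for x
  proof -
    have o: "open {x::real\<times>real. snd x > 0}" by (intro open_Collect_less continuous_intros)
    have "x \<in> U" using that by (auto simp: U_def upper_half_def)
    from has_derivative_subset[OF dpU[OF this], of "{x. snd x > 0}"] show ?thesis
      using at_within_open[OF _ o, of x] that by (auto simp: upper_half_def less_imp_le subset_iff)
  qed
  have smp: "Ck k {x. snd x > 0} p" for k
  proof -
    have "Ck k (upper_half - {0}) v" using sol by (simp add: sol_half_def smooth_on_def)
    then have 1: "Ck k {x. snd x > 0} v" by (rule Ck_subset) (auto simp: upper_half_def)
    have 2: "Ck k {x. snd x > 0} \<eta>" using \<eta>(1) Ck_subset unfolding smooth_on_def by blast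
    have "Ck k {x. snd x > 0} (\<lambda>x. exp ((1/2) * v x + (\<beta> + 1) * ln (norm x)) * (\<eta> x * \<eta> x))"
      by (intro Ck_mult Ck_exp Ck_add Ck_const Ck_ln_norm 1 2) auto
    then show ?thesis by (rule Ck_cong) (simp add: p_def P_def w_def power2_eq_square)
  qed
  have "(LINT x:upper_half|lborel. D1 x) = 0"
  proof (rule LINT_upper_half_horizontal_derivative[OF cont(5)])
    show "F1 x = 0" "D1 x = 0" if "norm x \<ge> R" for x using out' far that by auto
    fix x assume x: "x \<in> upper_half"
    show "((\<lambda>s. F1 (s, snd x)) has_real_derivative D1 x) (at (fst x))"
    proof (cases "x = 0")
      case True
      have "((\<lambda>_. 0) has_real_derivative 0) (at (0::real))" by simp
      then have "((\<lambda>s. F1 (s, 0)) has_real_derivative 0) (at 0)"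
        by (rule has_field_derivative_transform_within_open[where S = "ball 0 (exp a)"])
           (use out' near in \<open>auto simp: norm_Pair\<close>)
      then show ?thesis using True out'[OF near, of 0] by simp
    next
      case False
      then have xU: "x \<in> U" using x by (simp add: U_def)
      show ?thesis unfolding F1_def
        using DERIV_mult[OF DERIV_power[OF upper_half_partials(1)[OF dpU[OF xU] x], of 2] dw1[OF xU]]
        by (rule DERIV_cong) (simp add: D1_def algebra_simps)
    qed
  qed (rule R)
  moreover have "(LINT x:upper_half|lborel. D2 x) = - integral {- R..R} (\<lambda>s. F2 (s, 0))"
  proof (rule LINT_upper_half_vertical_derivative[OF cont(6)])
    show "F2 x = 0" "D2 x = 0" if "norm x \<ge> R" for x using out' far that by auto
    fix x assume x: "x \<in> upper_half"
    show "((\<lambda>t. F2 (fst x, t)) has_real_derivative D2 x) (at (snd x) within {0..})"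
    proof (cases "x = 0")
      case True
      have "((\<lambda>_. 0) has_real_derivative 0) (at (0::real))" by simp
      then have "((\<lambda>t. F2 (0, t)) has_real_derivative 0) (at 0)"
        by (rule has_field_derivative_transform_within_open[where S = "ball 0 (exp a)"])
           (use out' near in \<open>auto simp: norm_Pair\<close>)
      then show ?thesis using True out'[OF near, of 0] by (simp add: has_field_derivative_at_within)
    next
      case False
      then have xU: "x \<in> U" using x by (simp add: U_def)
      show ?thesis unfolding F2_def
        using DERIV_mult[OF DERIV_power[OF upper_half_partials(2)[OF dpU[OF xU] x], of 2] dw2[OF xU]]
        by (rule DERIV_cong) (simp add: D2_def algebra_simps)
    qed
  qed (rule R)
  moreover have "integral {- R..R} (\<lambda>s. F2 (s, 0)) = - (LINT s|lborel. B s * (p (s, 0))\<^sup>2)"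
  proof -
    \<comment> \<open>On the boundary the \<open>ln\<close> part of \<open>w2\<close> has the factor
      \<open>snd x = 0\<close>, so \<open>w2\<close> is half of \<open>v2\<close>. The boundary
      condition, with its factor 2, makes this exactly minus the boundary weight; hence the
      cancellation.\<close>
    have F2B: "B s * (p (s, 0))\<^sup>2 = - F2 (s, 0)" for s
    proof (cases "s = 0")
      case True
      then show ?thesis using out'[OF near, of "(0, 0)"] by (simp flip: zero_prod_def)
    next
      case False
      then show ?thesis using bdv[of s] by (simp add: F2_def w2_def B_def algebra_simps)
    qed
    have "(LINT s:UNIV|lborel. - F2 (s, 0)) = integral {- R..R} (\<lambda>s. - F2 (s, 0))"
    proof (rule LINT_eq_integral_compact(2))
      show "continuous_on {- R..R} (\<lambda>s. - F2 (s, 0))"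
        by (intro continuous_on_minus continuous_on_compose2[OF cont(4)]) (auto intro!: continuous_intros simp: upper_half_def)
      show "- F2 (s, 0) = 0" if "s \<in> UNIV - {- R..R}" for s
      proof -
        have "norm (s, 0::real) \<ge> R" using that by (auto simp: norm_Pair)
        then show ?thesis using out'(5) far by simp
      qed
    qed auto
    then show ?thesis by (simp add: F2B set_lebesgue_integral_def)
  qed
  moreover have "(LINT x:upper_half|lborel. A x) \<le> (LINT x:upper_half|lborel. D1 x) + (LINT x:upper_half|lborel. D2 x) 
      + 8 / K0 * (LINT x:upper_half|lborel. X x) - K0 / 2 * (LINT x:upper_half|lborel. Y x)"
  proof -
    have int: "set_integrable lborel upper_half f" if "continuous_on upper_half f" "\<And>x. x \<notin> annulus a b \<Longrightarrow> f x = 0" for f :: "real \<times> real \<Rightarrow> real"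
      using that far by (intro LINT_upper_half(1)[of f R]) auto
    have iD1: "set_integrable lborel upper_half D1" and iD2: "set_integrable lborel upper_half D2"
      and iA: "set_integrable lborel upper_half A" and iX: "set_integrable lborel upper_half X" 
      and iY: "set_integrable lborel upper_half Y"
      using int cont out' by blast+
    have pw: "A x \<le> D1 x + D2 x + 8 / K0 * X x - K0 / 2 * Y x" if "x \<in> upper_half" for x
    proof (cases "x = 0")
      case True
      then show ?thesis using out'[of x] by simp
    next
      case False
      then have xU: "x \<in> U" using that by (simp add: U_def)
      define q where "q = (P x)\<^sup>2"
      define G where "G = (\<eta>1 x)\<^sup>2 + (\<eta>2 x)\<^sup>2"
      define e where "e = (\<eta> x)\<^sup>2"
      have w22: "w22 x = - K0 * W x - w11 x" using lapw[OF xU] by simp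
      have "A x - D1 x - D2 x = q * (4 * e * G - K0 * W x * e\<^sup>2 - ((w1 x)\<^sup>2 + (w2 x)\<^sup>2) * e\<^sup>2)"
        using weighted_energy_identity[of "P x" "w1 x" "\<eta> x" "\<eta>1 x" "w2 x" "\<eta>2 x" K0 "W x" "w11 x"]
        unfolding A_def D1_def D2_def w22 p1_def p2_def p_def q_def V_def G_def e_def by simp
      \<comment> \<open>The term with \<open>|grad w|^2\<close> has the favourable sign and is
        dropped, so no bound on the gradient of the solution is required.\<close>
      also have "\<dots> \<le> q * (4 * e * G - K0 * W x * e\<^sup>2)"
        by (intro mult_left_mono) (auto simp: q_def)
      also have "\<dots> = (norm x)\<^sup>2 * (4 * (W x * e) * G - K0 * (W x * e)\<^sup>2)"
        unfolding q_def P2[OF False] by (simp add: algebra_simps power2_eq_square)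
      also have "\<dots> \<le> (norm x)\<^sup>2 * (8 / K0 * G\<^sup>2 - K0 / 2 * (W x * e)\<^sup>2)"
      proof (intro mult_left_mono)
        \<comment> \<open>Completing this square absorbs the mixed term into half of
          \<open>K0 (W \<eta>^2)^2\<close>; the constants \<open>8 / K0\<close> and
          \<open>K0 / 2\<close> come from here.\<close>
        have "0 \<le> (4 * G - K0 * (W x * e))\<^sup>2 / (2 * K0)" using K0 by simp
        also have "\<dots> = 8 / K0 * G\<^sup>2 - 4 * (W x * e) * G + K0 / 2 * (W x * e)\<^sup>2"
          using K0 by (simp add: field_simps power2_eq_square)
        finally show "4 * (W x * e) * G - K0 * (W x * e)\<^sup>2 \<le> 8 / K0 * G\<^sup>2 - K0 / 2 * (W x * e)\<^sup>2"
          by (simp add: algebra_simps)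
      qed simp
      also have "\<dots> = 8 / K0 * X x - K0 / 2 * Y x"
        by (simp add: X_def Y_def G_def e_def algebra_simps power_mult_distrib flip: power_mult)
      finally show ?thesis by simp
    qed
    define Z where "Z x = D1 x + D2 x + 8 / K0 * X x - K0 / 2 * Y x" for x
    have iZ: "set_integrable lborel upper_half Z" unfolding Z_def
      by (intro set_integral_diff set_integral_add set_integrable_mult_right iD1 iD2 iX iY)
    have "(LINT x:upper_half|lborel. A x) \<le> (LINT x:upper_half|lborel. Z x)"
      using pw by (intro set_integral_mono iA iZ) (simp add: Z_def)
    also have "\<dots> = (LINT x:upper_half|lborel. D1 x) + (LINT x:upper_half|lborel. D2 x) 
      + 8 / K0 * (LINT x:upper_half|lborel. X x) - K0 / 2 * (LINT x:upper_half|lborel. Y x)"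
      unfolding Z_def
      by (simp add: set_integral_diff set_integral_add set_integrable_mult_right iD1 iD2 iX iY)
    finally show ?thesis .
  qed
  ultimately have "(LINT x:upper_half|lborel. A x) - (LINT s|lborel. B s * (p (s, 0))\<^sup>2) < 0"
    using neg unfolding X_def Y_def \<eta>1_def \<eta>2_def by linarith
  then have "\<exists>\<phi>. smooth_on UNIV \<phi> \<and> (\<forall>x. x \<notin> annulus a' b' \<longrightarrow> \<phi> x = 0) \<and> quad_form upper_half V B \<phi> < 0"
    unfolding A_def
  proof (intro negative_quad_form_upward_shift[OF cont(1-3) _ _ smp dp _ ab])
    show "continuous_on (upper_half - {0}) V" unfolding V_def
      by (intro continuous_intros cU(6)[unfolded U_def])
    show "continuous_on (- {0}) B" unfolding B_def
      by (intro continuous_intros continuous_on_compose2[OF cv(1)]) (auto simp: upper_half_def zero_prod_def)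
    show "p x = 0 \<and> p1 x = 0 \<and> p2 x = 0" if "x \<notin> annulus a b" for x using out'[OF that] by simp
  qed
  then show ?thesis by (simp add: V_def[abs_def] B_def[abs_def])
qed

lemma morse_index_half_plane_solution:
  assumes K0: "K0 > 0" and sol: "sol_half K0 \<beta> h0 v"
  shows "morse_index (Q_half K0 \<beta> h0 v) \<ge> 1"
    and "(\<integral>\<^sup>+x\<in>upper_half. ennreal (norm x powr (2*\<beta>) * exp (v x)) \<partial>lborel) = \<infinity> \<Longrightarrow> morse_index (Q_half K0 \<beta> h0 v) = \<infinity>"
proof -
  define W where "W = (\<lambda>x::real\<times>real. norm x powr (2*\<beta>) * exp (v x))"
  define V where "V = (\<lambda>x. 2 * K0 * W x)"
  define B where "B = (\<lambda>s. h0 * \<bar>s\<bar> powr \<beta> * exp (v (s, 0) / 2))"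
  have Q: "Q_half K0 \<beta> h0 v = quad_form upper_half V B"
    by (rule ext) (simp add: Q_half_def quad_form_def V_def W_def B_def mult.assoc)
  have cl: "closed upper_half" unfolding upper_half_def by (intro closed_Collect_le continuous_intros)
  have cv: "continuous_on (upper_half - {0}) v"
    using sol Ck_imp_continuous by (auto simp: sol_half_def smooth_on_def)
  have cW: "continuous_on (upper_half - {0}) W" unfolding W_def
    by (intro continuous_intros cv) auto
  then have cV: "continuous_on (upper_half - {0}) V" unfolding V_def by (intro continuous_intros)
  have cB: "continuous_on (- {0}) B" unfolding B_def
    by (intro continuous_intros continuous_on_compose2[OF cv]) (auto simp: upper_half_def zero_prod_def)
  have Wpos: "W x > 0" if "x \<in> upper_half - {0}" for x using that by (simp add: W_def)
  have loc: "set_integrable lborel (K \<inter> upper_half) W" if "compact K" for K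
    using sol that by (simp add: sol_half_def W_def)
  obtain C where C: "C > 0" and cut: "\<And>T N. N \<ge> 1 \<Longrightarrow> (\<exists>\<eta>. smooth_on UNIV \<eta> \<and> (\<forall>x. 0 \<le> \<eta> x \<and> \<eta> x \<le> 1) \<and>
     (\<forall>x. x \<notin> annulus (T + 1) (T + 3 * real N + 1) \<longrightarrow> \<eta> x = 0) \<and>
     (\<forall>x\<in>annulus (T + real N + 1) (T + 2 * real N + 1). \<eta> x = 1) \<and>
     (\<forall>S. closed S \<longrightarrow>
        (LINT x:S|lborel. (d1 \<eta> x)\<^sup>2 + (d2 \<eta> x)\<^sup>2) \<le> C / real N \<and>
        (LINT x:S|lborel. (norm x)\<^sup>2 * ((d1 \<eta> x)\<^sup>2 + (d2 \<eta> x)\<^sup>2)\<^sup>2) \<le> C / real N ^ 3))"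
    using ex_cutoff_energy by blast
  obtain M where M: "M > 0" and ann: "\<And>a n S. closed S \<Longrightarrow> (LINT x:annulus a (a + real n) \<inter> S|lborel. 1 / (norm x)\<^sup>2) \<le> M * real n"
    using annulus_inverse_square_bound by blast
  \<comment> \<open>If \<open>neg\<close> fails, \<open>|x|^2 W^2\<close> has integral at most
    \<open>16 C / (K0^2 N^3)\<close> over the middle third. Multiplied by \<open>N^2 / 2\<close> and
    added to \<open>M N / (2 N^2)\<close> this is \<open>C' / N\<close>.\<close>
  define C' where "C' = (16 * C / K0\<^sup>2 + M) / 2"
  have dich: "(\<exists>\<phi> b. smooth_on UNIV \<phi> \<and> (\<forall>x. x \<notin> annulus T b \<longrightarrow> \<phi> x = 0) \<and> quad_form upper_half V B \<phi> < 0)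
         \<or> (LINT x:annulus (T + real N + 1) (T + 2 * real N + 1) \<inter> upper_half|lborel. W x) \<le> C' / real N"
    if N: "N \<ge> 1" for T N
  proof (rule disjCI)
    let ?A = "annulus (T + real N + 1) (T + 2 * real N + 1) \<inter> upper_half"
    assume big: "\<not> (LINT x:?A|lborel. W x) \<le> C' / real N"
    obtain \<eta> where \<eta>: "smooth_on UNIV \<eta>" "\<And>x. 0 \<le> \<eta> x \<and> \<eta> x \<le> 1"
     "\<And>x. x \<notin> annulus (T + 1) (T + 3 * real N + 1) \<Longrightarrow> \<eta> x = 0"
     "\<And>x. x \<in> annulus (T + real N + 1) (T + 2 * real N + 1) \<Longrightarrow> \<eta> x = 1"
     "(LINT x:upper_half|lborel. (norm x)\<^sup>2 * ((d1 \<eta> x)\<^sup>2 + (d2 \<eta> x)\<^sup>2)\<^sup>2) \<le> C / real N ^ 3"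
      using cut[OF N, of T] cl by blast
    define Y where "Y x = (norm x)\<^sup>2 * (W x)\<^sup>2" for x :: "real \<times> real"
    have cY: "continuous_on (upper_half - {0}) Y" unfolding Y_def by (intro continuous_intros cW)
    have iW: "set_integrable lborel ?A W" by (rule set_integrable_annulus[OF cl cW])
    have iY: "set_integrable lborel ?A Y" by (rule set_integrable_annulus[OF cl cY])
    have iI: "set_integrable lborel ?A (\<lambda>x. 1 / (norm x)\<^sup>2)"
      by (intro set_integrable_annulus cl continuous_intros) auto
    \<comment> \<open>Cauchy-Schwarz in pointwise form, splitting \<open>W\<close> into
      \<open>|x| W\<close> times \<open>1 / |x|\<close>. The weight \<open>N^2\<close> balances the
      two sides: \<open>N^2 N^-3\<close> and \<open>N^-2 N\<close> are both
      \<open>1 / N\<close>.\<close>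
    have "(LINT x:?A|lborel. W x) \<le> (LINT x:?A|lborel. (real N)\<^sup>2 / 2 * Y x + 1 / (2 * (real N)\<^sup>2) * (1 / (norm x)\<^sup>2))"
    proof (rule set_integral_mono[OF iW])
      show "set_integrable lborel ?A (\<lambda>x. (real N)\<^sup>2 / 2 * Y x + 1 / (2 * (real N)\<^sup>2) * (1 / (norm x)\<^sup>2))"
        by (intro set_integral_add set_integrable_mult_right iY iI)
      fix x assume "x \<in> ?A"
      then have x: "norm x > 0" using zero_notin_annulus by auto
      have "0 \<le> (real N * norm x * W x - 1 / (real N * norm x))\<^sup>2 / 2" by simp
      also have "\<dots> = (real N)\<^sup>2 / 2 * Y x + 1 / (2 * (real N)\<^sup>2) * (1 / (norm x)\<^sup>2) - W x"
        using x N by (simp add: Y_def power2_diff field_simps power_mult_distrib) (simp add: power2_eq_square algebra_simps)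
      finally show "W x \<le> (real N)\<^sup>2 / 2 * Y x + 1 / (2 * (real N)\<^sup>2) * (1 / (norm x)\<^sup>2)" by simp
    qed
    also have "\<dots> = (real N)\<^sup>2 / 2 * (LINT x:?A|lborel. Y x) + 1 / (2 * (real N)\<^sup>2) * (LINT x:?A|lborel. 1 / (norm x)\<^sup>2)"
    proof -
      have "set_integrable lborel ?A (\<lambda>x. (real N)\<^sup>2 / 2 * Y x)"
        "set_integrable lborel ?A (\<lambda>x. 1 / (2 * (real N)\<^sup>2) * (1 / (norm x)\<^sup>2))"
        by (intro set_integrable_mult_right iY iI)+
      from set_integral_add(2)[OF this] show ?thesis by (simp only: set_integral_mult_right)
    qed
    also have "\<dots> \<le> (real N)\<^sup>2 / 2 * (LINT x:?A|lborel. Y x) + 1 / (2 * (real N)\<^sup>2) * (M * real N)"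
      using ann[OF cl, of "T + real N + 1" N] by (intro add_left_mono mult_left_mono) (auto simp: algebra_simps)
    also have "1 / (2 * (real N)\<^sup>2) * (M * real N) = M / (2 * real N)" using N by (simp add: power2_eq_square)
    finally have "C' / real N < (real N)\<^sup>2 / 2 * (LINT x:?A|lborel. Y x) + M / (2 * real N)" using big by linarith
    then have "8 * C / K0\<^sup>2 / real N < (real N)\<^sup>2 / 2 * (LINT x:?A|lborel. Y x)"
      by (simp add: C'_def add_divide_distrib)
    then have bigY: "8 / K0 * (C / real N ^ 3) < K0 / 2 * (LINT x:?A|lborel. Y x)"
      using N K0 by (simp add: field_simps power2_eq_square power3_eq_cube)
    have le: "(LINT x:?A|lborel. Y x) \<le> (LINT x:upper_half|lborel. (norm x)\<^sup>2 * (W x)\<^sup>2 * \<eta> x ^ 4)"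
    proof -
      let ?K = "annulus (T + 1) (T + 3 * real N + 1) \<inter> upper_half"
      have c\<eta>: "continuous_on (upper_half - {0}) \<eta>" 
        using smooth_C1(2)[OF \<eta>(1)] continuous_on_subset by blast
      have "continuous_on (upper_half - {0}) (\<lambda>x. (norm x)\<^sup>2 * (W x)\<^sup>2 * \<eta> x ^ 4)"
        by (intro continuous_intros cW c\<eta>)
      then have "continuous_on ?K (\<lambda>x. (norm x)\<^sup>2 * (W x)\<^sup>2 * \<eta> x ^ 4)"
        by (rule continuous_on_subset) auto
      moreover have "(norm x)\<^sup>2 * (W x)\<^sup>2 * \<eta> x ^ 4 = 0" if "x \<in> upper_half - ?K" for x
        using \<eta>(3)[of x] that by auto
      ultimately have i: "set_integrable lborel upper_half (\<lambda>x. (norm x)\<^sup>2 * (W x)\<^sup>2 * \<eta> x ^ 4)"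
        by (intro LINT_eq_integral_compact(1)[of ?K] compact_annulus_Int cl) auto
      show ?thesis unfolding set_lebesgue_integral_def
        by (rule integral_mono) (use iY i \<eta>(4) in \<open>auto simp: set_integrable_def indicator_def Y_def\<close>)
    qed
    have "8 / K0 * (LINT x:upper_half|lborel. (norm x)\<^sup>2 * ((d1 \<eta> x)\<^sup>2 + (d2 \<eta> x)\<^sup>2)\<^sup>2) \<le> 8 / K0 * (C / real N ^ 3)"
      using \<eta>(5) K0 by (intro mult_left_mono) auto
    also note bigY
    also have "K0 / 2 * (LINT x:?A|lborel. Y x) \<le> K0 / 2 * (LINT x:upper_half|lborel. (norm x)\<^sup>2 * (W x)\<^sup>2 * \<eta> x ^ 4)"
      using le K0 by (intro mult_left_mono) auto
    \<comment> \<open>The cutoff is supported between \<open>T + 1\<close> and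
      \<open>T + 3 N + 1\<close>; a margin of 1 is left on either side for the vertical
      shift.\<close>
    finally have "\<exists>\<phi>. smooth_on UNIV \<phi> \<and> (\<forall>x. x \<notin> annulus T (T + 3 * real N + 2) \<longrightarrow> \<phi> x = 0) \<and>
       quad_form upper_half (\<lambda>x. 2 * K0 * W x) (\<lambda>s. h0 * \<bar>s\<bar> powr \<beta> * exp (v (s, 0) / 2)) \<phi> < 0"
      by (intro half_negative_test_fun[OF K0 sol \<eta>(1,3) _ _ W_def]) auto
    then show "\<exists>\<phi> b. smooth_on UNIV \<phi> \<and> (\<forall>x. x \<notin> annulus T b \<longrightarrow> \<phi> x = 0) \<and> quad_form upper_half V B \<phi> < 0"
      unfolding V_def B_def by blast
  qed
  have half: "(1/2::real) > 0" by simp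
  show "morse_index (Q_half K0 \<beta> h0 v) \<ge> 1" unfolding Q
    by (rule morse_index_dichotomy(1)[OF cl cV cB cW Wpos loc half cball_in_annulus dich])
  assume "(\<integral>\<^sup>+x\<in>upper_half. ennreal (norm x powr (2*\<beta>) * exp (v x)) \<partial>lborel) = \<infinity>"
  then show "morse_index (Q_half K0 \<beta> h0 v) = \<infinity>" unfolding Q
    by (intro morse_index_dichotomy(2)[OF cl cV cB cW Wpos loc half cball_in_annulus dich]) (auto simp: W_def)
qed

theorem theorem4p5:
  fixes K0 \<alpha> \<beta> h0 :: real
  assumes "K0 > 0" and "\<alpha> > -1" and "\<beta> > -1"
  shows "(\<forall>v. sol_plane K0 \<alpha> v \<longrightarrow>
            morse_index (Q_plane K0 \<alpha> v) \<ge> 1 \<and>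
            ((\<integral>\<^sup>+x. ennreal (norm x powr (2*\<alpha>) * exp (v x)) \<partial>lborel) = \<infinity>
               \<longrightarrow> morse_index (Q_plane K0 \<alpha> v) = \<infinity>))
       \<and> (\<forall>v. sol_half K0 \<beta> h0 v \<longrightarrow>
            morse_index (Q_half K0 \<beta> h0 v) \<ge> 1 \<and>
            ((\<integral>\<^sup>+x\<in>upper_half. ennreal (norm x powr (2*\<beta>) * exp (v x)) \<partial>lborel) = \<infinity>
               \<longrightarrow> morse_index (Q_half K0 \<beta> h0 v) = \<infinity>))"
  using morse_index_plane_solution[OF assms(1)] morse_index_half_plane_solution[OF assms(1)] by blast

end
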